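(* Let $\mathbb L$ be a right invariant Lagrangian on $G\times G$, and let $\ell:(G\times G)/G\cong G\to\mathbb R$ be the restriction of $\mathbb L$ to $G$ given by $\ell(g_1g_2^{-1})=\mathbb L(g_1,g_2)$. For any integer $N\ge 3$, let $\{(g_k,g_{k+1})\}_{k=0}^{N-1}$ be a sequence in $G\times G$ and define $f_{k\,k+1}\equiv g_kg_{k+1}^{-1}$ to be the corresponding sequence in $G$. Then the following are equivalent. (1) The sequence $\{(g_k,g_{k+1})\}_{k=0}^{N-1}$ is an extremum of the action sum $\mathbb S:G^{N+1}\to\mathbb R$, $\mathbb S=\sum_{k=0}^{N-1}\mathbb L(g_k,g_{k+1})$, for arbitrary variations $\delta g_k=\frac{d}{d\epsilon}\big|_{\epsilon=0}g_k^\epsilon$, where for each $k$, $\epsilon\mapsto g_k^\epsilon$ is a smooth curve in $G$ such that $g_k^0=g_k$. (2) The sequence $\{(g_k,g_{k+1})\}_{k=0}^{N-1}$ satisfies the discrete Euler-Lagrange equations $$D_2\mathbb L(g_{k-1},g_k)+D_1\mathbb L(g_k,g_{k+1})=0,\qquad k=1,\dots,N-1.$$ (3) The sequence $\{f_{k\,k+1}\}_{k=0}^{N-1}$ is an extremum of the reduced action sum $s:G^N\to\mathbb R$, $s=\sum_{k=0}^{N-1}\ell(f_{k\,k+1})$, with respect to variations $\delta f_{k\,k+1}$, induced by the variations $\delta g_k$, and given by $$\delta f_{k\,k+1}=TR_{f_{k\,k+1}}\bigl(\delta g_k\,g_k^{-1}-\operatorname{Ad}_{f_{k\,k+1}}\cdot\delta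 g_{k+1}\,g_{k+1}^{-1}\bigr).$$ (4) The sequence $\{f_{k\,k+1}\}_{k=0}^{N-1}$ satisfies the discrete Euler-Poincaré equations $$-\ell'(f_{k-1\,k})\operatorname{Ad}_{f_{k-1\,k}}TR_{f_{k-1\,k}}+\ell'(f_{k\,k+1})\,TR_{f_{k\,k+1}}=0$$ for $k=1,\dots,N-1$, where the operators act on variations of the form $\vartheta_k=\delta g_k\,g_k^{-1}$.
   Context: $G$ is a finite-dimensional Lie group with Lie algebra $\mathfrak g$. A (differentiable) function $\mathbb L:G\times G\to\mathbb R$ is right invariant if $\mathbb L(g_1\bar g,g_2\bar g)=\mathbb L(g_1,g_2)$ for all $g_1,g_2,\bar g\in G$; the quotient of $G\times G$ by this diagonal right action is identified with $G$ through $(g_1,g_2)\mapsto g_1g_2^{-1}$. $D_1\mathbb L$ and $D_2\mathbb L$ are the partial differentials of $\mathbb L$ in its first and second arguments. $\ell'(f)\in T_f^*G$ is the differential of $\ell$ at $f$. $R_f(g)=gf$ is right translation, $TR_f$ its tangent map, here from $\mathfrak g=T_eG$ to $T_fG$; for $v\in T_gG$, $v\,g^{-1}\in\mathfrak g$ denotes $TR_{g^{-1}}v$. $\operatorname{Ad}$ is the adjoint action of $G$ on $\mathfrak g$. In (4) the first term is to be read, when applied to $\vartheta_k\in\mathfrak g$, as $-\ell'(f_{k-1\,k})$ evaluated on $TR_{f_{k-1\,k}}(\operatorname{Ad}_{f_{k-1\,k}}\vartheta_k)$, and the second as $\ell'(f_{k\,k+1})$ evaluated on $TR_{f_{k\,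k+1}}(\vartheta_k)$.
   Formalization: The variations in (1), and those they induce in (3), keep the end points fixed (δg_0 = δg_N = 0); with free end points (2) does not imply (1), e.g. G = ℝ, L(x,y) = x − y. "Extremum" means critical point. *)

theory Defs
  imports "HOL-Analysis.Analysis" "HOL-Algebra.Group"
begin

section \<open>Finite-dimensional smooth manifolds\<close>

text \<open>
  \<open>C_k_on k f S\<close> is meant for open \<open>S\<close> in a finite-dimensional space: \<open>f\<close> is \<open>k\<close> times
  continuously differentiable there iff it is differentiable and all its directional
  derivatives are of class \<open>k - 1\<close>.
\<close>

fun C_k_on :: "nat \<Rightarrow> ('a::real_normed_vector \<Rightarrow> 'b::real_normed_vector) \<Rightarrow> 'a set \<Rightarrow> bool" where
  "C_k_on 0 f S \<longleftrightarrow> continuous_on S f"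
| "C_k_on (Suc k) f S \<longleftrightarrow>
     (\<forall>x\<in>S. f differentiable (at x)) \<and>
     (\<forall>v. C_k_on k (\<lambda>x. frechet_derivative f (at x) v) S)"

definition smooth_on :: "('a::real_normed_vector \<Rightarrow> 'b::real_normed_vector) \<Rightarrow> 'a set \<Rightarrow> bool" where
  "smooth_on f S \<longleftrightarrow> (\<forall>k. C_k_on k f S)"

text \<open>
  A chart is a domain together with a coordinate map; values of the map outside the domain are
  irrelevant, and the inverse chart is \<open>inv_into U \<phi>\<close>.
\<close>

type_synonym ('m, 'e) chart = "'m set \<times> ('m \<Rightarrow> 'e)"

record ('m, 'e) manifold =
  topol :: "'m topology"
  atlas :: "('m, 'e) chart set"

text \<open>
  The model space is an arbitrary finite-dimensional normed space rather than a
  \<open>euclidean_space\<close>, because the latter class excludes dimension \<open>0\<close>.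
  The atlas need not be maximal.  Second countability is not demanded, so that uncountable
  discrete groups, say, are also covered.
\<close>

definition smooth_manifold :: "('m, 'e::real_normed_vector) manifold \<Rightarrow> bool" where
  "smooth_manifold M \<longleftrightarrow>
     (\<exists>B::'e set. finite B \<and> span B = UNIV) \<and>
     Hausdorff_space (topol M) \<and>
     \<Union> (fst ` atlas M) = topspace (topol M) \<and>
     (\<forall>(U, \<phi>)\<in>atlas M.
        openin (topol M) U \<and> open (\<phi> ` U) \<and>
        homeomorphic_map (subtopology (topol M) U) (top_of_set (\<phi> ` U)) \<phi>) \<and>
     (\<forall>(U, \<phi>)\<in>atlas M. \<forall>(V, \<psi>)\<in>atlas M. smooth_on (\<psi> \<circ> inv_into U \<phi>) (\<phi> ` (U \<inter> V)))"

definition prod_manifold ::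
  "('m, 'e) manifold \<Rightarrow> ('n, 'f) manifold \<Rightarrow> ('m \<times> 'n, 'e \<times> 'f) manifold" where
  "prod_manifold M N =
     \<lparr>topol = prod_topology (topol M) (topol N),
      atlas = {(U \<times> V, map_prod \<phi> \<psi>) |U \<phi> V \<psi>. (U, \<phi>) \<in> atlas M \<and> (V, \<psi>) \<in> atlas N}\<rparr>"

text \<open>An open subset of a normed space as a manifold.\<close>

definition open_submanifold :: "'e::real_normed_vector set \<Rightarrow> ('e, 'e) manifold" where
  "open_submanifold S = \<lparr>topol = top_of_set S, atlas = {(S, \<lambda>x. x)}\<rparr>"

definition smooth_map ::
  "('m, 'e::real_normed_vector) manifold \<Rightarrow> ('n, 'f::real_normed_vector) manifold
     \<Rightarrow> ('m \<Rightarrow> 'n) \<Rightarrow> bool" where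
  "smooth_map M N F \<longleftrightarrow>
     continuous_map (topol M) (topol N) F \<and>
     (\<forall>(U, \<phi>)\<in>atlas M. \<forall>(V, \<psi>)\<in>atlas N.
        smooth_on (\<psi> \<circ> F \<circ> inv_into U \<phi>) (\<phi> ` (U \<inter> F -` V)))"

definition differentiable_fun ::
  "('m, 'e::real_normed_vector) manifold \<Rightarrow> ('m \<Rightarrow> real) \<Rightarrow> bool" where
  "differentiable_fun M F \<longleftrightarrow>
     (\<forall>(U, \<phi>)\<in>atlas M. \<forall>p\<in>U. (F \<circ> inv_into U \<phi>) differentiable (at (\<phi> p)))"

text \<open>Smooth curves through the parameter value \<open>0\<close>; they need only be defined near \<open>0\<close>.\<close>

definition smooth_curve :: "('m, 'e::real_normed_vector) manifold \<Rightarrow> (real \<Rightarrow> 'm) \<Rightarrow> bool" where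
  "smooth_curve M c \<longleftrightarrow> (\<exists>r>0. smooth_map (open_submanifold {-r<..<r}) M c)"


section \<open>Tangent vectors and differentials\<close>

definition charts_at :: "('m, 'e) manifold \<Rightarrow> 'm \<Rightarrow> ('m, 'e) chart set" where
  "charts_at M p = {(U, \<phi>) \<in> atlas M. p \<in> U}"

text \<open>
  A tangent vector at \<open>p\<close> is the family of its coordinate representations in all charts around
  \<open>p\<close>, related by the derivatives of the transition maps (and \<open>0\<close> at everything that is not
  a chart around \<open>p\<close>, so that equality of tangent vectors is equality of functions).
  The vector space operations are the pointwise ones.
\<close>

type_synonym ('m, 'e) tvec = "('m, 'e) chart \<Rightarrow> 'e"

definition tangent_space ::
  "('m, 'e::real_normed_vector) manifold \<Rightarrow> 'm \<Rightarrow> ('m, 'e) tvec set" where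
  "tangent_space M p =
     {v. (\<forall>c. c \<notin> charts_at M p \<longrightarrow> v c = 0) \<and>
         (\<forall>(U, \<phi>)\<in>charts_at M p. \<forall>(V, \<psi>)\<in>charts_at M p.
            v (V, \<psi>) = frechet_derivative (\<psi> \<circ> inv_into U \<phi>) (at (\<phi> p)) (v (U, \<phi>)))}"

definition zero_tvec :: "('m, 'e::real_normed_vector) tvec" where
  "zero_tvec = (\<lambda>c. 0)"

text \<open>The velocity \<open>d/d\<epsilon>\<close> at \<open>\<epsilon> = 0\<close> of a curve.\<close>

definition velocity ::
  "('m, 'e::real_normed_vector) manifold \<Rightarrow> (real \<Rightarrow> 'm) \<Rightarrow> ('m, 'e) tvec" where
  "velocity M c = (\<lambda>(U, \<phi>).
     if (U, \<phi>) \<in> charts_at M (c 0) then vector_derivative (\<phi> \<circ> c) (at 0) else 0)"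

text \<open>
  Tangent map and differential at \<open>p\<close>, computed in some chart around \<open>p\<close>; by the chain rule the
  choice is immaterial for maps that are differentiable at \<open>p\<close> and vectors tangent at \<open>p\<close>.
\<close>

definition tangent_map ::
  "('m, 'e::real_normed_vector) manifold \<Rightarrow> ('n, 'f::real_normed_vector) manifold
     \<Rightarrow> ('m \<Rightarrow> 'n) \<Rightarrow> 'm \<Rightarrow> ('m, 'e) tvec \<Rightarrow> ('n, 'f) tvec" where
  "tangent_map M N F p v = (\<lambda>(V, \<psi>).
     if (V, \<psi>) \<in> charts_at N (F p)
     then let (U, \<phi>) = (SOME c. c \<in> charts_at M p)
          in frechet_derivative (\<psi> \<circ> F \<circ> inv_into U \<phi>) (at (\<phi> p)) (v (U, \<phi>))
     else 0)"

definition differential ::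
  "('m, 'e::real_normed_vector) manifold \<Rightarrow> ('m \<Rightarrow> real) \<Rightarrow> 'm \<Rightarrow> ('m, 'e) tvec \<Rightarrow> real" where
  "differential M F p v =
     (let (U, \<phi>) = (SOME c. c \<in> charts_at M p)
      in frechet_derivative (F \<circ> inv_into U \<phi>) (at (\<phi> p)) (v (U, \<phi>)))"

definition D1 ::
  "('m, 'e::real_normed_vector) manifold \<Rightarrow> ('m \<times> 'm \<Rightarrow> real) \<Rightarrow> 'm \<times> 'm \<Rightarrow> ('m, 'e) tvec \<Rightarrow> real" where
  "D1 M L = (\<lambda>(p, q). differential M (\<lambda>x. L (x, q)) p)"

definition D2 ::
  "('m, 'e::real_normed_vector) manifold \<Rightarrow> ('m \<times> 'm \<Rightarrow> real) \<Rightarrow> 'm \<times> 'm \<Rightarrow> ('m, 'e) tvec \<Rightarrow> real" where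
  "D2 M L = (\<lambda>(p, q). differential M (\<lambda>y. L (p, y)) q)"


section \<open>Lie groups\<close>

locale lie_group = group G
  for G :: "('g, 'x) monoid_scheme" (structure)
    and M :: "('g, 'e::real_normed_vector) manifold" +
  assumes manifold: "smooth_manifold M"
    and topspace_eq_carrier: "topspace (topol M) = carrier G"
    and smooth_mult: "smooth_map (prod_manifold M M) M (\<lambda>(x, y). x \<otimes> y)"
    and smooth_inv: "smooth_map M M (\<lambda>x. inv x)"

abbreviation lie_algebra ::
  "('g, 'x) monoid_scheme \<Rightarrow> ('g, 'e::real_normed_vector) manifold \<Rightarrow> ('g, 'e) tvec set" where
  "lie_algebra G M \<equiv> tangent_space M \<one>\<^bsub>G\<^esub>"

text \<open>
  \<open>TR G M f p\<close> is the tangent map at \<open>p\<close> of the right translation by \<open>f\<close>.  In particular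
  \<open>TR G M (inv\<^bsub>G\<^esub> g) g v\<close> is \<open>v g\<^sup>-\<^sup>1\<close> for \<open>v\<close> tangent at \<open>g\<close>.
\<close>

definition TR ::
  "('g, 'x) monoid_scheme \<Rightarrow> ('g, 'e::real_normed_vector) manifold \<Rightarrow> 'g \<Rightarrow> 'g
     \<Rightarrow> ('g, 'e) tvec \<Rightarrow> ('g, 'e) tvec" where
  "TR G M f p = tangent_map M M (\<lambda>g. g \<otimes>\<^bsub>G\<^esub> f) p"

definition Ad ::
  "('g, 'x) monoid_scheme \<Rightarrow> ('g, 'e::real_normed_vector) manifold \<Rightarrow> 'g
     \<Rightarrow> ('g, 'e) tvec \<Rightarrow> ('g, 'e) tvec" where
  "Ad G M f = tangent_map M M (\<lambda>h. f \<otimes>\<^bsub>G\<^esub> h \<otimes>\<^bsub>G\<^esub> inv\<^bsub>G\<^esub> f) \<one>\<^bsub>G\<^esub>"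

definition right_invariant :: "('g, 'x) monoid_scheme \<Rightarrow> ('g \<times> 'g \<Rightarrow> real) \<Rightarrow> bool" where
  "right_invariant G L \<longleftrightarrow>
     (\<forall>g1\<in>carrier G. \<forall>g2\<in>carrier G. \<forall>h\<in>carrier G.
        L (g1 \<otimes>\<^bsub>G\<^esub> h, g2 \<otimes>\<^bsub>G\<^esub> h) = L (g1, g2))"


section \<open>Discrete variational principles\<close>

text \<open>
  ``Extremum'' is meant in the sense of the calculus of variations: the sequence \<open>x\<close>, indexed
  by \<open>I\<close>, is a critical point of \<open>S\<close> for the variations \<open>\<delta>\<close> in \<open>W\<close>, that is, the derivative of
  \<open>S\<close> at \<open>\<epsilon> = 0\<close> vanishes along all families of smooth curves that start at \<open>x\<close> with velocity \<open>\<delta>\<close>.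
\<close>

definition extremal_for ::
  "('m, 'e::real_normed_vector) manifold \<Rightarrow> nat set \<Rightarrow> ((nat \<Rightarrow> 'm) \<Rightarrow> real) \<Rightarrow> (nat \<Rightarrow> 'm)
     \<Rightarrow> (nat \<Rightarrow> ('m, 'e) tvec) set \<Rightarrow> bool" where
  "extremal_for M I S x W \<longleftrightarrow>
     (\<forall>\<delta>\<in>W. \<forall>\<gamma>.
        (\<forall>i\<in>I. smooth_curve M (\<gamma> i) \<and> \<gamma> i 0 = x i \<and> velocity M (\<gamma> i) = \<delta> i) \<longrightarrow>
        ((\<lambda>\<epsilon>. S (\<lambda>i. \<gamma> i \<epsilon>)) has_real_derivative 0) (at 0))"

text \<open>
  As usual for Hamilton's principle, the variations of \<open>g\<^sub>0, \<dots>, g\<^sub>N\<close> are arbitrary except that the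
  end points are kept fixed; with free end points one would get additional boundary conditions.
\<close>

definition variations ::
  "('m, 'e::real_normed_vector) manifold \<Rightarrow> nat \<Rightarrow> (nat \<Rightarrow> 'm) \<Rightarrow> (nat \<Rightarrow> ('m, 'e) tvec) set" where
  "variations M N g =
     {\<delta>g. (\<forall>k\<le>N. \<delta>g k \<in> tangent_space M (g k)) \<and> \<delta>g 0 = zero_tvec \<and> \<delta>g N = zero_tvec}"

definition action_sum :: "('g \<times> 'g \<Rightarrow> real) \<Rightarrow> nat \<Rightarrow> (nat \<Rightarrow> 'g) \<Rightarrow> real" where
  "action_sum L N g = (\<Sum>k<N. L (g k, g (Suc k)))"

definition reduced_action_sum :: "('g \<Rightarrow> real) \<Rightarrow> nat \<Rightarrow> (nat \<Rightarrow> 'g) \<Rightarrow> real" where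
  "reduced_action_sum l N f = (\<Sum>k<N. l (f k))"

text \<open>
  \<open>f k\<close> stands for \<open>f\<^sub>k\<^sub>,\<^sub>k\<^sub>+\<^sub>1\<close>.  Subtraction of tangent vectors is subtraction of functions.
\<close>

definition reduced_sequence :: "('g, 'x) monoid_scheme \<Rightarrow> (nat \<Rightarrow> 'g) \<Rightarrow> nat \<Rightarrow> 'g" where
  "reduced_sequence G g k = g k \<otimes>\<^bsub>G\<^esub> inv\<^bsub>G\<^esub> (g (Suc k))"

definition reduced_variation ::
  "('g, 'x) monoid_scheme \<Rightarrow> ('g, 'e::real_normed_vector) manifold \<Rightarrow> (nat \<Rightarrow> 'g)
     \<Rightarrow> (nat \<Rightarrow> ('g, 'e) tvec) \<Rightarrow> nat \<Rightarrow> ('g, 'e) tvec" where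
  "reduced_variation G M g \<delta>g k =
     TR G M (reduced_sequence G g k) \<one>\<^bsub>G\<^esub>
       (TR G M (inv\<^bsub>G\<^esub> (g k)) (g k) (\<delta>g k) -
        Ad G M (reduced_sequence G g k)
          (TR G M (inv\<^bsub>G\<^esub> (g (Suc k))) (g (Suc k)) (\<delta>g (Suc k))))"

definition discrete_euler_lagrange ::
  "('m, 'e::real_normed_vector) manifold \<Rightarrow> ('m \<times> 'm \<Rightarrow> real) \<Rightarrow> nat \<Rightarrow> (nat \<Rightarrow> 'm) \<Rightarrow> bool" where
  "discrete_euler_lagrange M L N g \<longleftrightarrow>
     (\<forall>k\<in>{1..N-1}. \<forall>v\<in>tangent_space M (g k).
        D2 M L (g (k - 1), g k) v + D1 M L (g k, g (k + 1)) v = 0)"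

definition discrete_euler_poincare ::
  "('g, 'x) monoid_scheme \<Rightarrow> ('g, 'e::real_normed_vector) manifold \<Rightarrow> ('g \<Rightarrow> real) \<Rightarrow> nat
     \<Rightarrow> (nat \<Rightarrow> 'g) \<Rightarrow> bool" where
  "discrete_euler_poincare G M l N f \<longleftrightarrow>
     (\<forall>k\<in>{1..N-1}. \<forall>\<theta>\<in>lie_algebra G M.
        - differential M l (f (k - 1)) (TR G M (f (k - 1)) \<one>\<^bsub>G\<^esub> (Ad G M (f (k - 1)) \<theta>))
        + differential M l (f k) (TR G M (f k) \<one>\<^bsub>G\<^esub> \<theta>) = 0)"

end

theory Submission
  imports Defs
begin

text \<open>
  Let \<open>c\<^sub>k\<close> be curves through the points \<open>g\<^sub>k\<close>. By the chain rule the derivative of the action at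
  \<open>\<epsilon> = 0\<close> is \<open>\<Sum>k<N. D\<^sub>1L(g\<^sub>k, g\<^sub>k\<^sub>+\<^sub>1) \<delta>g\<^sub>k + D\<^sub>2L(g\<^sub>k, g\<^sub>k\<^sub>+\<^sub>1) \<delta>g\<^sub>k\<^sub>+\<^sub>1\<close>, a function of the variations
  only. Since the variations vanish at the end points, summation by parts turns it into a sum over
  the interior indices of the Euler-Lagrange expressions applied to \<open>\<delta>g\<^sub>k\<close>; the \<open>\<delta>g\<^sub>k\<close> are
  independent, so it vanishes for all variations iff every Euler-Lagrange expression vanishes
  (\<open>sum_vanishes_iff_stationary\<close>).

  The reduced action takes the same values along the curves \<open>c\<^sub>k c\<^sub>k\<^sub>+\<^sub>1\<^sup>-\<^sup>1\<close>. Their velocity is the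
  induced variation \<open>TR\<^sub>f (\<delta>g\<^sub>k g\<^sub>k\<^sup>-\<^sup>1 - Ad\<^sub>f (\<delta>g\<^sub>k\<^sub>+\<^sub>1 g\<^sub>k\<^sub>+\<^sub>1\<^sup>-\<^sup>1))\<close> (\<open>has_velocity_quotient\<close>). Hence the
  differential of the reduced Lagrangian on the induced variation is exactly the \<open>k\<close>-th summand
  above (\<open>reduced_differential\<close>), and the two variational principles have the same first variation.
  The same identity with one of the two variations equal to \<open>0\<close> shows that the Euler-Poincare
  expression on \<open>\<theta> = \<delta>g\<^sub>k g\<^sub>k\<^sup>-\<^sup>1\<close> is the Euler-Lagrange expression on \<open>\<delta>g\<^sub>k\<close>; right translation
  being a bijection from the tangent space at \<open>g\<^sub>k\<close> to the Lie algebra, the two systems of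
  equations are equivalent.

  All identities between tangent vectors are obtained by differentiating identities between curves.
  This works because every tangent vector is the velocity of a smooth curve
  (\<open>tangent_vector_has_curve\<close>) and a curve has only one velocity (\<open>has_velocity_unique\<close>).
\<close>

section \<open>Charts\<close>

lemma C_k_on_cong:
  assumes "open S" and "\<And>x. x \<in> S \<Longrightarrow> f x = h x" and "C_k_on k f S"
  shows "C_k_on k h S"
  using assms(2,3)
proof (induction k arbitrary: f h)
  case 0
  then show ?case by (auto cong: continuous_on_cong)
next
  case (Suc k)
  have diff: "f differentiable (at x)" if "x \<in> S" for x
    using Suc.prems(2) that by simp
  have diff': "h differentiable (at x)" if "x \<in> S" for x
    using diff[OF that] Suc.prems(1) assms(1) that
    unfolding differentiable_def by (meson has_derivative_transform_within_open)
  have "frechet_derivative f (at x) = frechet_derivative h (at x)" if "x \<in> S" for x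
    by (rule frechet_derivative_transform_within_open[OF diff[OF that] assms(1) that Suc.prems(1)])
  then have "C_k_on k (\<lambda>x. frechet_derivative h (at x) v) S" for v
    using Suc.IH[of "\<lambda>x. frechet_derivative f (at x) v"] Suc.prems(2) by simp
  with diff' show ?case by simp
qed

text \<open>
  Straight lines are the only curves in coordinates whose composition with transition maps has to be
  smooth. The induction closes without a product or chain rule for higher derivatives: each derivative
  of the composition is the composition of a directional derivative of \<open>h\<close> with the same line.
\<close>

lemma C_k_on_compose_line:
  fixes h :: "'a::real_normed_vector \<Rightarrow> 'b::real_normed_vector" and a v :: 'a
  assumes "C_k_on k h S" and "open T" and "\<And>t. t \<in> T \<Longrightarrow> a + t *\<^sub>R v \<in> S"
  shows "C_k_on k (\<lambda>t::real. h (a + t *\<^sub>R v)) T"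
  using assms(1)
proof (induction k arbitrary: h)
  case 0
  have "continuous_on T (\<lambda>t. a + t *\<^sub>R v)"
    by (intro continuous_intros)
  with 0 assms(3) show ?case
    by (auto intro!: continuous_on_compose2[of S h])
next
  case (Suc k)
  have deriv: "((\<lambda>t. h (a + t *\<^sub>R v)) has_derivative
      (\<lambda>s. frechet_derivative h (at (a + t *\<^sub>R v)) (s *\<^sub>R v))) (at t)" if "t \<in> T" for t
  proof (rule has_derivative_compose[where g = h])
    show "((\<lambda>t. a + t *\<^sub>R v) has_derivative (\<lambda>s. s *\<^sub>R v)) (at t)"
      by (auto intro!: derivative_eq_intros)
    show "(h has_derivative frechet_derivative h (at (a + t *\<^sub>R v))) (at (a + t *\<^sub>R v))"
      using Suc.prems assms(3)[OF that] by (simp add: frechet_derivative_works)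
  qed
  have "C_k_on k (\<lambda>t. frechet_derivative (\<lambda>t. h (a + t *\<^sub>R v)) (at t) s) T" for s
  proof (rule C_k_on_cong[OF assms(2)])
    show "C_k_on k (\<lambda>t. frechet_derivative h (at (a + t *\<^sub>R v)) (s *\<^sub>R v)) T"
      using Suc.IH[of "\<lambda>x. frechet_derivative h (at x) (s *\<^sub>R v)"] Suc.prems by simp
    show "frechet_derivative h (at (a + t *\<^sub>R v)) (s *\<^sub>R v)
        = frechet_derivative (\<lambda>t. h (a + t *\<^sub>R v)) (at t) s" if "t \<in> T" for t
      using frechet_derivative_at[OF deriv[OF that]] by metis
  qed
  moreover have "(\<lambda>t. h (a + t *\<^sub>R v)) differentiable (at t)" if "t \<in> T" for t
    using deriv[OF that] by (auto simp: differentiable_def)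
  ultimately show ?case by simp
qed

lemma smooth_on_differentiable:
  assumes "smooth_on f S" and "x \<in> S"
  shows "f differentiable (at x)"
proof -
  have "C_k_on (Suc 0) f S" using assms(1) unfolding smooth_on_def by blast
  with assms(2) show ?thesis by simp
qed

lemma chart_in_atlas: "(U, \<phi>) \<in> charts_at M p \<Longrightarrow> (U, \<phi>) \<in> atlas M"
  and chart_mem: "(U, \<phi>) \<in> charts_at M p \<Longrightarrow> p \<in> U"
  by (auto simp: charts_at_def)

context
  fixes M :: "('m, 'e::real_normed_vector) manifold"
  assumes M: "smooth_manifold M"
begin

lemma
  assumes "(U, \<phi>) \<in> atlas M"
  shows chart_openin: "openin (topol M) U"
    and chart_open_image: "open (\<phi> ` U)"
    and chart_homeomorphic: "homeomorphic_map (subtopology (topol M) U) (top_of_set (\<phi> ` U)) \<phi>"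
    and transition_smooth: "(V, \<psi>) \<in> atlas M \<Longrightarrow> smooth_on (\<psi> \<circ> inv_into U \<phi>) (\<phi> ` (U \<inter> V))"
proof -
  have charts: "\<forall>(U, \<phi>)\<in>atlas M. openin (topol M) U \<and> open (\<phi> ` U) \<and>
      homeomorphic_map (subtopology (topol M) U) (top_of_set (\<phi> ` U)) \<phi>"
    using M unfolding smooth_manifold_def by (elim conjE)
  have transitions: "\<forall>(U, \<phi>)\<in>atlas M. \<forall>(V, \<psi>)\<in>atlas M.
      smooth_on (\<psi> \<circ> inv_into U \<phi>) (\<phi> ` (U \<inter> V))"
    using M unfolding smooth_manifold_def by (elim conjE)
  show "openin (topol M) U" "open (\<phi> ` U)"
    "homeomorphic_map (subtopology (topol M) U) (top_of_set (\<phi> ` U)) \<phi>"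
    using bspec[OF charts assms] by simp_all
  show "smooth_on (\<psi> \<circ> inv_into U \<phi>) (\<phi> ` (U \<inter> V))" if "(V, \<psi>) \<in> atlas M"
    using bspec[OF bspec[OF transitions assms, simplified split] that] by simp
qed

lemma chart_inj:
  assumes "(U, \<phi>) \<in> atlas M"
  shows "inj_on \<phi> U"
proof -
  have "topspace (subtopology (topol M) U) = U"
    using openin_subset[OF chart_openin[OF assms]] by auto
  with homeomorphic_imp_injective_map[OF chart_homeomorphic[OF assms]] show ?thesis by simp
qed

lemma chart_open_image_openin:
  assumes "(U, \<phi>) \<in> atlas M" and "openin (topol M) W" and "W \<subseteq> U"
  shows "open (\<phi> ` W)"
proof -
  have "openin (subtopology (topol M) U) W"
    using assms(2,3) by (auto simp: openin_subtopology)
  then have "openin (top_of_set (\<phi> ` U)) (\<phi> ` W)"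
    using homeomorphic_imp_open_map[OF chart_homeomorphic[OF assms(1)]] by (simp add: open_map_def)
  then show ?thesis
    using chart_open_image[OF assms(1)] openin_open_trans by blast
qed

lemma charts_at_nonempty:
  assumes "p \<in> topspace (topol M)"
  obtains U \<phi> where "(U, \<phi>) \<in> charts_at M p"
proof -
  have "p \<in> \<Union> (fst ` atlas M)" using assms M by (simp add: smooth_manifold_def)
  then show ?thesis using that by (auto simp: charts_at_def)
qed

lemma some_chart:
  assumes "p \<in> topspace (topol M)"
  shows "(SOME c. c \<in> charts_at M p) \<in> charts_at M p"
  using charts_at_nonempty[OF assms] someI_ex[of "\<lambda>c. c \<in> charts_at M p"] by metis

end

section \<open>Velocities of curves\<close>

text \<open>
  First-order contact of a curve with \<open>v\<close> at parameter \<open>0\<close>, in every chart around \<open>p\<close> simultaneously.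
  In contrast to \<^const>\<open>velocity\<close> it includes that the curve is differentiable and stays in each chart
  near \<open>0\<close>, and in contrast to \<^const>\<open>smooth_curve\<close> it asks only for one derivative, so that the
  chain rules below need no higher smoothness. That \<open>v\<close> vanishes off the charts at \<open>p\<close> makes it unique.
\<close>

definition has_velocity ::
  "('m, 'e::real_normed_vector) manifold \<Rightarrow> (real \<Rightarrow> 'm) \<Rightarrow> 'm \<Rightarrow> ('m, 'e) tvec \<Rightarrow> bool" where
  "has_velocity M c p v \<longleftrightarrow>
     c 0 = p \<and> p \<in> topspace (topol M) \<and> (\<forall>x. x \<notin> charts_at M p \<longrightarrow> v x = 0) \<and>
     (\<forall>(U, \<phi>)\<in>charts_at M p.
        (\<forall>\<^sub>F t in nhds 0. c t \<in> U) \<and>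
        ((\<lambda>t. \<phi> (c t)) has_vector_derivative v (U, \<phi>)) (at 0))"

lemma has_velocityI:
  assumes "c 0 = p" and "p \<in> topspace (topol M)"
    and "\<And>x. x \<notin> charts_at M p \<Longrightarrow> v x = 0"
    and "\<And>U \<phi>. (U, \<phi>) \<in> charts_at M p \<Longrightarrow> \<forall>\<^sub>F t in nhds 0. c t \<in> U"
    and "\<And>U \<phi>. (U, \<phi>) \<in> charts_at M p \<Longrightarrow>
      ((\<lambda>t. \<phi> (c t)) has_vector_derivative v (U, \<phi>)) (at 0)"
  shows "has_velocity M c p v"
  using assms unfolding has_velocity_def by auto

lemma has_velocityD:
  assumes "has_velocity M c p v"
  shows "c 0 = p" and "p \<in> topspace (topol M)"
    and "x \<notin> charts_at M p \<Longrightarrow> v x = 0"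
    and "(U, \<phi>) \<in> charts_at M p \<Longrightarrow> \<forall>\<^sub>F t in nhds 0. c t \<in> U"
    and "(U, \<phi>) \<in> charts_at M p \<Longrightarrow> ((\<lambda>t. \<phi> (c t)) has_vector_derivative v (U, \<phi>)) (at 0)"
proof -
  have *: "\<forall>(U, \<phi>)\<in>charts_at M p. (\<forall>\<^sub>F t in nhds 0. c t \<in> U) \<and>
      ((\<lambda>t. \<phi> (c t)) has_vector_derivative v (U, \<phi>)) (at 0)"
    using assms unfolding has_velocity_def by (elim conjE)
  show "c 0 = p" and "p \<in> topspace (topol M)" and "x \<notin> charts_at M p \<Longrightarrow> v x = 0"
    using assms unfolding has_velocity_def by blast+
  show "\<forall>\<^sub>F t in nhds 0. c t \<in> U" and "((\<lambda>t. \<phi> (c t)) has_vector_derivative v (U, \<phi>)) (at 0)"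
    if "(U, \<phi>) \<in> charts_at M p"
    using bspec[OF * that] by simp_all
qed

lemma has_velocity_imp_velocity:
  assumes "has_velocity M c p v"
  shows "velocity M c = v"
proof
  fix x :: "('a, 'b) chart"
  obtain U \<phi> where x: "x = (U, \<phi>)" by fastforce
  show "velocity M c x = v x"
    using has_velocityD[OF assms] vector_derivative_at[OF has_velocityD(5)[OF assms, of U \<phi>]]
    by (auto simp: velocity_def x comp_def)
qed

lemma has_velocity_unique:
  "has_velocity M c p v \<Longrightarrow> has_velocity M c p w \<Longrightarrow> v = w"
  using has_velocity_imp_velocity by metis

lemma has_vector_derivative_eventually:
  assumes "(f has_vector_derivative v) (at x)" and "\<forall>\<^sub>F t in nhds x. f t = h t"
  shows "(h has_vector_derivative v) (at x)"
  using assms has_vector_derivative_cong_ev[of UNIV f h x v] eventually_nhds_x_imp_x[of "\<lambda>t. f t = h t" x]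
  by (simp add: eventually_mono)

text \<open>
  Group laws hold along a curve only where it lies in the carrier, that is near parameter \<open>0\<close>; this
  suffices for transporting velocities.
\<close>

lemma has_velocity_cong:
  assumes "has_velocity M c p v" and ev: "\<forall>\<^sub>F t in nhds 0. c t = d t"
  shows "has_velocity M d p v"
proof -
  have "d 0 = c 0" using eventually_nhds_x_imp_x[OF ev] by simp
  moreover have "\<forall>\<^sub>F t in nhds 0. d t \<in> U" if "\<forall>\<^sub>F t in nhds 0. c t \<in> U" for U
    using that ev by eventually_elim simp
  moreover have "((\<lambda>t. \<phi> (d t)) has_vector_derivative w) (at 0)"
    if "((\<lambda>t. \<phi> (c t)) has_vector_derivative w) (at 0)" for \<phi> :: "'a \<Rightarrow> 'b" and w
    by (rule has_vector_derivative_eventually[OF that]) (use ev in eventually_elim, simp)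
  ultimately show ?thesis
    using has_velocityD[OF assms(1)] by (intro has_velocityI) auto
qed

lemma has_velocity_const:
  assumes "p \<in> topspace (topol M)"
  shows "has_velocity M (\<lambda>_. p) p zero_tvec"
  using assms by (auto simp: has_velocity_def zero_tvec_def charts_at_def)

lemma has_vector_derivative_compose_frechet:
  assumes "(f has_vector_derivative v) (at x)" and "h differentiable (at (f x))"
  shows "((\<lambda>t. h (f t)) has_vector_derivative frechet_derivative h (at (f x)) v) (at x)"
proof -
  have "(h has_derivative frechet_derivative h (at (f x))) (at (f x) within range f)"
    using assms(2) by (simp add: frechet_derivative_works has_derivative_at_withinI)
  from vector_derivative_diff_chain_within[OF assms(1) this] show ?thesis
    by (simp add: comp_def)
qed

lemma has_vector_derivative_nhds:
  assumes "(f has_vector_derivative v) (at x)" and "\<forall>\<^sub>F y in nhds (f x). P y"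
  shows "\<forall>\<^sub>F t in nhds x. P (f t)"
  using eventually_compose_filterlim[OF assms(2)] has_vector_derivative_continuous[OF assms(1)]
  by (simp add: continuous_at tendsto_at_iff_tendsto_nhds)

context
  fixes M :: "('m, 'e::real_normed_vector) manifold"
  assumes M: "smooth_manifold M"
begin

lemma transition_differentiable:
  assumes "(U, \<phi>) \<in> charts_at M p" and "(V, \<psi>) \<in> charts_at M p"
  shows "(\<psi> \<circ> inv_into U \<phi>) differentiable (at (\<phi> p))"
  using smooth_on_differentiable[OF transition_smooth[OF M]] assms by (auto simp: charts_at_def)

lemma has_velocity_eventually_carrier:
  assumes "has_velocity M c p v"
  shows "\<forall>\<^sub>F t in nhds 0. c t \<in> topspace (topol M)"
proof -
  obtain U \<phi> where c: "(U, \<phi>) \<in> charts_at M p"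
    using charts_at_nonempty[OF M has_velocityD(2)[OF assms]] .
  show ?thesis
    using has_velocityD(4)[OF assms c] openin_subset[OF chart_openin[OF M chart_in_atlas[OF c]]]
    by (auto elim: eventually_mono)
qed

text \<open>
  The compatibility condition on tangent vectors is the chain rule for \<open>\<psi> \<circ> c = (\<psi> \<circ> \<phi>\<^sup>-\<^sup>1) \<circ> (\<phi> \<circ> c)\<close>.
\<close>

lemma has_velocity_tangent:
  assumes "has_velocity M c p v"
  shows "v \<in> tangent_space M p"
proof -
  note v = has_velocityD[OF assms]
  have "v (V, \<psi>) = frechet_derivative (\<psi> \<circ> inv_into U \<phi>) (at (\<phi> p)) (v (U, \<phi>))"
    if U: "(U, \<phi>) \<in> charts_at M p" and V: "(V, \<psi>) \<in> charts_at M p" for U \<phi> V \<psi>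
  proof -
    have "((\<lambda>t. (\<psi> \<circ> inv_into U \<phi>) (\<phi> (c t))) has_vector_derivative
        frechet_derivative (\<psi> \<circ> inv_into U \<phi>) (at (\<phi> (c 0))) (v (U, \<phi>))) (at 0)"
      by (intro has_vector_derivative_compose_frechet v(5) U) (simp only: v(1) transition_differentiable[OF U V])
    moreover have "\<forall>\<^sub>F t in nhds 0. (\<psi> \<circ> inv_into U \<phi>) (\<phi> (c t)) = \<psi> (c t)"
      using v(4)[OF U] by eventually_elim (simp add: chart_inj[OF M chart_in_atlas[OF U]])
    ultimately show ?thesis
      using vector_derivative_at[OF has_vector_derivative_eventually] vector_derivative_at[OF v(5)[OF V]]
        v(1) by metis
  qed
  then show ?thesis
    unfolding tangent_space_def using v(3) by (intro CollectI conjI allI impI ballI; clarify)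
qed

lemma smooth_curve_has_velocity:
  assumes "smooth_curve M c"
  shows "has_velocity M c (c 0) (velocity M c)"
proof -
  obtain r where r: "r > 0" and c: "smooth_map (open_submanifold {-r<..<r}) M c"
    using assms by (auto simp: smooth_curve_def)
  let ?S = "{-r<..<r}"
  have cont: "continuous_map (top_of_set ?S) (topol M) c"
    and sm: "\<And>V \<psi>. (V, \<psi>) \<in> atlas M \<Longrightarrow>
      smooth_on (\<psi> \<circ> c \<circ> inv_into ?S (\<lambda>x. x)) ((\<lambda>x. x) ` (?S \<inter> c -` V))"
    using c by (auto simp: smooth_map_def open_submanifold_def)
  have "c 0 \<in> topspace (topol M)"
    using cont r by (auto simp: continuous_map_def)
  moreover have "\<forall>\<^sub>F t in nhds 0. c t \<in> U"
    and "((\<lambda>t. \<phi> (c t)) has_vector_derivative velocity M c (U, \<phi>)) (at 0)"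
    if U: "(U, \<phi>) \<in> charts_at M (c 0)" for U \<phi>
  proof -
    have "openin (top_of_set ?S) {t \<in> topspace (top_of_set ?S). c t \<in> U}"
      by (rule openin_continuous_map_preimage[OF cont chart_openin[OF M chart_in_atlas[OF U]]])
    then have op: "open (?S \<inter> c -` U)"
      using openin_open_trans[of ?S] by (simp add: vimage_def Int_def)
    have mem: "0 \<in> ?S \<inter> c -` U" using r chart_mem[OF U] by simp
    show "\<forall>\<^sub>F t in nhds 0. c t \<in> U"
      using op mem by (auto simp: eventually_nhds)
    have "(\<phi> \<circ> c \<circ> inv_into ?S (\<lambda>x. x)) differentiable (at 0)"
      using smooth_on_differentiable[OF sm[OF chart_in_atlas[OF U]]] mem by simp
    moreover have "(\<phi> \<circ> c \<circ> inv_into ?S (\<lambda>x. x)) t = (\<phi> \<circ> c) t" if "t \<in> ?S" for t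
      using inv_into_f_f[of "\<lambda>x. x" ?S t] that by simp
    ultimately have "(\<phi> \<circ> c) differentiable (at 0)"
      using r has_derivative_transform_within_open[of _ _ 0 UNIV ?S "\<phi> \<circ> c"]
      unfolding differentiable_def by fastforce
    then show "((\<lambda>t. \<phi> (c t)) has_vector_derivative velocity M c (U, \<phi>)) (at 0)"
      using U by (simp add: velocity_def vector_derivative_works[symmetric] comp_def)
  qed
  ultimately show ?thesis
    by (auto simp: has_velocity_def velocity_def)
qed

text \<open>
  The curve is the straight line in the direction of \<open>v\<close> in one chart around \<open>p\<close>; in the other charts
  it is smooth because the transition maps are, and its velocity is the one prescribed by \<open>v\<close> because
  \<open>v\<close> transforms by their derivatives.
\<close>

lemma tangent_vector_has_curve:
  assumes p: "p \<in> topspace (topol M)" and v: "v \<in> tangent_space M p"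
  obtains c where "smooth_curve M c" and "has_velocity M c p v"
proof -
  obtain U \<phi> where U: "(U, \<phi>) \<in> charts_at M p"
    using charts_at_nonempty[OF M p] .
  note atlas = chart_in_atlas[OF U] and pU = chart_mem[OF U]
  note inj = chart_inj[OF M atlas]
  define line where "line t = \<phi> p + t *\<^sub>R v (U, \<phi>)" for t :: real
  have line_cont: "continuous_on UNIV line"
    unfolding line_def by (intro continuous_intros)
  have line0: "line 0 = \<phi> p" by (simp add: line_def)
  have "open (line -` (\<phi> ` U))"
    using chart_open_image[OF M atlas] line_cont by (simp add: open_vimage)
  moreover have "0 \<in> line -` (\<phi> ` U)" using pU line0 by simp
  ultimately obtain r where r: "r > 0" and ball: "ball 0 r \<subseteq> line -` (\<phi> ` U)"
    by (meson open_contains_ball)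
  \<comment> \<open>On this interval the line does not leave the image of the chart, so it can be pulled back.\<close>
  let ?S = "{-r<..<r}"
  have S: "line t \<in> \<phi> ` U" if "t \<in> ?S" for t
  proof -
    have "t \<in> ball 0 r" using that by (auto simp: dist_real_def)
    with ball show ?thesis by blast
  qed
  define c where "c t = inv_into U \<phi> (line t)" for t
  have cU: "c t \<in> U" and \<phi>c: "\<phi> (c t) = line t" if "t \<in> ?S" for t
    using inv_into_into[OF S[OF that]] f_inv_into_f[OF S[OF that]] by (auto simp: c_def)
  have c0: "c 0 = p" by (simp add: c_def line0 inj pU)
  have preimage: "?S \<inter> c -` W = ?S \<inter> line -` (\<phi> ` (U \<inter> W))" for W
  proof -
    have "c t \<in> W \<longleftrightarrow> line t \<in> \<phi> ` (U \<inter> W)" if "t \<in> ?S" for t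
      using inj_on_image_mem_iff[OF inj cU[OF that], of "U \<inter> W"] cU[OF that] \<phi>c[OF that] by simp
    then show ?thesis by auto
  qed
  have preimage_open: "open (?S \<inter> c -` W)" if "openin (topol M) W" for W
    unfolding preimage
    by (intro open_Int open_vimage line_cont chart_open_image_openin[OF M atlas] openin_Int
        chart_openin[OF M atlas] that) auto
  have "smooth_curve M c"
    unfolding smooth_curve_def smooth_map_def open_submanifold_def
  proof (intro exI[of _ r] conjI r; clarsimp)
    show "continuous_map (top_of_set ?S) (topol M) c"
      using preimage_open cU openin_subset[OF chart_openin[OF M atlas]]
      by (fastforce simp: continuous_map_def openin_open_eq vimage_def Int_def)
    fix V \<psi> assume V: "(V, \<psi>) \<in> atlas M"
    show "smooth_on (\<psi> \<circ> c \<circ> inv_into ?S (\<lambda>x. x)) (?S \<inter> c -` V)"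
      unfolding smooth_on_def
    proof (rule allI, rule C_k_on_cong)
      show op: "open (?S \<inter> c -` V)" by (rule preimage_open[OF chart_openin[OF M V]])
      fix k
      have "C_k_on k (\<psi> \<circ> inv_into U \<phi>) (\<phi> ` (U \<inter> V))"
        using transition_smooth[OF M atlas V] by (simp add: smooth_on_def)
      then show "C_k_on k (\<lambda>t. (\<psi> \<circ> inv_into U \<phi>) (\<phi> p + t *\<^sub>R v (U, \<phi>))) (?S \<inter> c -` V)"
        using op
      proof (rule C_k_on_compose_line)
        show "\<phi> p + t *\<^sub>R v (U, \<phi>) \<in> \<phi> ` (U \<inter> V)" if "t \<in> ?S \<inter> c -` V" for t
          using that unfolding preimage by (simp add: line_def)
      qed
      show "(\<psi> \<circ> inv_into U \<phi>) (\<phi> p + t *\<^sub>R v (U, \<phi>)) = (\<psi> \<circ> c \<circ> inv_into ?S (\<lambda>x. x)) t"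
        if "t \<in> ?S \<inter> c -` V" for t
        using that inv_into_f_f[of "\<lambda>x. x" ?S t] by (simp add: c_def line_def)
    qed
  qed
  moreover have "velocity M c = v"
  proof
    fix x :: "('m, 'e) chart"
    obtain V \<psi> where x: "x = (V, \<psi>)" by fastforce
    show "velocity M c x = v x"
    proof (cases "(V, \<psi>) \<in> charts_at M p")
      case True
      have "(line has_vector_derivative v (U, \<phi>)) (at 0)"
        unfolding line_def by (auto intro!: derivative_eq_intros)
      moreover have "v (V, \<psi>) = frechet_derivative (\<psi> \<circ> inv_into U \<phi>) (at (line 0)) (v (U, \<phi>))"
        using v U True line0 by (fastforce simp: tangent_space_def)
      ultimately have "((\<lambda>t. (\<psi> \<circ> inv_into U \<phi>) (line t)) has_vector_derivative v (V, \<psi>)) (at 0)"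
        using has_vector_derivative_compose_frechet[of line "v (U, \<phi>)" 0 "\<psi> \<circ> inv_into U \<phi>"]
          transition_differentiable[OF U True] line0 by metis
      then show ?thesis
        using True c0 vector_derivative_at[of "\<psi> \<circ> c"] by (simp add: velocity_def x c_def comp_def)
    next
      case False
      then show ?thesis using v c0 by (simp add: velocity_def x tangent_space_def)
    qed
  qed
  ultimately show ?thesis
    using that smooth_curve_has_velocity c0 by metis
qed

end

section \<open>Differentiability at a point\<close>

text \<open>
  Differentiability in charts; the eventuality condition, a consequence of continuity at \<open>p\<close>, ensures
  that the coordinate expression is meaningful near the image of \<open>p\<close>.
\<close>

definition diff_at ::
  "('m, 'e::real_normed_vector) manifold \<Rightarrow> ('n, 'f::real_normed_vector) manifold
     \<Rightarrow> ('m \<Rightarrow> 'n) \<Rightarrow> 'm \<Rightarrow> bool" where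
  "diff_at M N F p \<longleftrightarrow>
     p \<in> topspace (topol M) \<and> F p \<in> topspace (topol N) \<and>
     (\<forall>U \<phi> V \<psi>. (U, \<phi>) \<in> charts_at M p \<longrightarrow> (V, \<psi>) \<in> charts_at N (F p) \<longrightarrow>
        (\<forall>\<^sub>F x in nhds (\<phi> p). F (inv_into U \<phi> x) \<in> V) \<and>
        (\<psi> \<circ> F \<circ> inv_into U \<phi>) differentiable (at (\<phi> p)))"

lemma diff_atD:
  assumes "diff_at M N F p"
  shows "p \<in> topspace (topol M)" and "F p \<in> topspace (topol N)"
    and "(U, \<phi>) \<in> charts_at M p \<Longrightarrow> (V, \<psi>) \<in> charts_at N (F p) \<Longrightarrow>
      \<forall>\<^sub>F x in nhds (\<phi> p). F (inv_into U \<phi> x) \<in> V"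
    and "(U, \<phi>) \<in> charts_at M p \<Longrightarrow> (V, \<psi>) \<in> charts_at N (F p) \<Longrightarrow>
      (\<psi> \<circ> F \<circ> inv_into U \<phi>) differentiable (at (\<phi> p))"
  using assms unfolding diff_at_def by blast+

lemma differentiable_eventually:
  assumes "f differentiable (at x)" and "\<forall>\<^sub>F y in nhds x. f y = h y"
  shows "h differentiable (at x)"
proof -
  obtain D where D: "(f has_derivative D) (at x)" using assms(1) by (auto simp: differentiable_def)
  have "\<forall>\<^sub>F y in at x. f y = h y"
    using assms(2) by (auto simp: eventually_at_filter elim: eventually_mono)
  from has_derivative_transform_eventually[OF D this eventually_nhds_x_imp_x[OF assms(2)] UNIV_I]
  show ?thesis by (auto simp: differentiable_def)
qed

lemma differentiable_nhds:
  assumes "f differentiable (at x)" and "\<forall>\<^sub>F y in nhds (f x). P y"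
  shows "\<forall>\<^sub>F y in nhds x. P (f y)"
  using eventually_compose_filterlim[OF assms(2)] differentiable_imp_continuous_within[OF assms(1)]
  by (simp add: continuous_at tendsto_at_iff_tendsto_nhds)

lemma diff_at_compose:
  assumes M: "smooth_manifold M" and N: "smooth_manifold N"
    and F: "diff_at M N F p" and H: "diff_at N P H (F p)"
  shows "diff_at M P (\<lambda>x. H (F x)) p"
  unfolding diff_at_def
proof (intro conjI allI impI)
  show "p \<in> topspace (topol M)" and "H (F p) \<in> topspace (topol P)"
    using diff_atD(1)[OF F] diff_atD(2)[OF H] by simp_all
next
  fix U \<phi> W \<eta>
  assume U: "(U, \<phi>) \<in> charts_at M p" and W: "(W, \<eta>) \<in> charts_at P (H (F p))"
  obtain V \<psi> where V: "(V, \<psi>) \<in> charts_at N (F p)"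
    using charts_at_nonempty[OF N diff_atD(2)[OF F]] .
  let ?F = "\<psi> \<circ> F \<circ> inv_into U \<phi>" and ?H = "\<eta> \<circ> H \<circ> inv_into V \<psi>"
  note F' = diff_atD(4)[OF F U V] and H' = diff_atD(4)[OF H V W]
  have "inv_into U \<phi> (\<phi> p) = p"
    by (simp add: chart_inj[OF M chart_in_atlas[OF U]] chart_mem[OF U])
  then have Fp: "?F (\<phi> p) = \<psi> (F p)" by simp
  have inv: "inv_into V \<psi> (?F x) = F (inv_into U \<phi> x)" if "F (inv_into U \<phi> x) \<in> V" for x
    using that by (simp add: chart_inj[OF N chart_in_atlas[OF V]])
  have "\<forall>\<^sub>F y in nhds (?F (\<phi> p)). H (inv_into V \<psi> y) \<in> W"
    unfolding Fp by (rule diff_atD(3)[OF H V W])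
  then have "\<forall>\<^sub>F x in nhds (\<phi> p). H (inv_into V \<psi> (?F x)) \<in> W"
    by (rule differentiable_nhds[OF F'])
  then show "\<forall>\<^sub>F x in nhds (\<phi> p). H (F (inv_into U \<phi> x)) \<in> W"
    using diff_atD(3)[OF F U V] by eventually_elim (simp only: inv)
  have "?H differentiable (at (?F (\<phi> p)))"
    unfolding Fp by (rule H')
  then have "(?H \<circ> ?F) differentiable (at (\<phi> p))"
    by (rule differentiable_chain_at[OF F'])
  then show "(\<eta> \<circ> (\<lambda>x. H (F x)) \<circ> inv_into U \<phi>) differentiable (at (\<phi> p))"
    by (rule differentiable_eventually)
      (use diff_atD(3)[OF F U V] in eventually_elim, simp add: inv[unfolded comp_def])
qed

lemma tangent_map_chart:
  assumes "(V, \<psi>) \<in> charts_at N (F p)"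
  shows "tangent_map M N F p v (V, \<psi>) =
    (case SOME c. c \<in> charts_at M p of (U, \<phi>) \<Rightarrow>
       frechet_derivative (\<psi> \<circ> F \<circ> inv_into U \<phi>) (at (\<phi> p)) (v (U, \<phi>)))"
  using assms by (simp add: tangent_map_def)

lemma tangent_map_outside: "c \<notin> charts_at N (F p) \<Longrightarrow> tangent_map M N F p v c = 0"
  by (auto simp: tangent_map_def split: prod.split)

text \<open>
  Although \<^const>\<open>tangent_map\<close> is computed in one arbitrarily chosen chart at \<open>p\<close>, it gives the velocity
  of the image curve, because \<open>v\<close> is the velocity of \<open>c\<close> in every chart.
\<close>

lemma has_velocity_tangent_map:
  assumes M: "smooth_manifold M" and F: "diff_at M N F p" and c: "has_velocity M c p v"
  shows "has_velocity N (\<lambda>t. F (c t)) (F p) (tangent_map M N F p v)"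
proof (rule has_velocityI)
  show "F (c 0) = F p" and "F p \<in> topspace (topol N)"
    using has_velocityD(1)[OF c] diff_atD(2)[OF F] by simp_all
  show "tangent_map M N F p v x = 0" if "x \<notin> charts_at N (F p)" for x
    using tangent_map_outside that .
next
  fix V \<psi> assume V: "(V, \<psi>) \<in> charts_at N (F p)"
  obtain U \<phi> where some: "(SOME c. c \<in> charts_at M p) = (U, \<phi>)" by fastforce
  then have U: "(U, \<phi>) \<in> charts_at M p"
    using some_chart[OF M diff_atD(1)[OF F]] by simp
  note c' = has_velocityD[OF c]
  note ev = c'(4)[OF U] and deriv = c'(5)[OF U]
  have inv: "inv_into U \<phi> (\<phi> (c t)) = c t" if "c t \<in> U" for t
    using that by (simp add: chart_inj[OF M chart_in_atlas[OF U]])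
  have "\<forall>\<^sub>F t in nhds 0. F (inv_into U \<phi> (\<phi> (c t))) \<in> V"
    using has_vector_derivative_nhds[OF deriv, of "\<lambda>x. F (inv_into U \<phi> x) \<in> V"]
      diff_atD(3)[OF F U V] by (simp only: c'(1))
  then show "\<forall>\<^sub>F t in nhds 0. F (c t) \<in> V"
    using ev by eventually_elim (simp only: inv)
  have "((\<lambda>t. (\<psi> \<circ> F \<circ> inv_into U \<phi>) (\<phi> (c t))) has_vector_derivative tangent_map M N F p v (V, \<psi>)) (at 0)"
    using has_vector_derivative_compose_frechet[OF deriv, of "\<psi> \<circ> F \<circ> inv_into U \<phi>"]
      diff_atD(4)[OF F U V] by (simp only: c'(1) tangent_map_chart[where F = F, OF V] some prod.case)
  then show "((\<lambda>t. \<psi> (F (c t))) has_vector_derivative tangent_map M N F p v (V, \<psi>)) (at 0)"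
    by (rule has_vector_derivative_eventually) (use ev in eventually_elim, simp only: inv comp_apply)
qed

lemma tangent_map_diff:
  assumes M: "smooth_manifold M" and F: "diff_at M N F p"
  shows "tangent_map M N F p (v - w) = tangent_map M N F p v - tangent_map M N F p w"
proof
  fix x :: "('c, 'd) chart"
  obtain V \<psi> where x: "x = (V, \<psi>)" by fastforce
  obtain U \<phi> where some: "(SOME c. c \<in> charts_at M p) = (U, \<phi>)" by fastforce
  then have U: "(U, \<phi>) \<in> charts_at M p"
    using some_chart[OF M diff_atD(1)[OF F]] by simp
  show "tangent_map M N F p (v - w) x = (tangent_map M N F p v - tangent_map M N F p w) x"
  proof (cases "x \<in> charts_at N (F p)")
    case True
    then show ?thesis
      using linear_diff[OF linear_frechet_derivative[OF diff_atD(4)[OF F U]]]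
      by (simp add: x tangent_map_chart some)
  qed (simp add: tangent_map_outside)
qed

lemma tangent_map_zero:
  assumes M: "smooth_manifold M" and F: "diff_at M N F p"
  shows "tangent_map M N F p zero_tvec = zero_tvec"
  using tangent_map_diff[OF assms, of zero_tvec zero_tvec] by (simp add: zero_tvec_def fun_diff_def)

lemma smooth_map_diff_at:
  assumes M: "smooth_manifold M" and N: "smooth_manifold N" and F: "smooth_map M N F"
    and p: "p \<in> topspace (topol M)"
  shows "diff_at M N F p"
  unfolding diff_at_def
proof (intro conjI allI impI)
  have cont: "continuous_map (topol M) (topol N) F"
    using F by (simp add: smooth_map_def)
  with p show "p \<in> topspace (topol M)" "F p \<in> topspace (topol N)"
    by (auto simp: continuous_map_def)
  fix U \<phi> V \<psi>
  assume U: "(U, \<phi>) \<in> charts_at M p" and V: "(V, \<psi>) \<in> charts_at N (F p)"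
  note U' = chart_in_atlas[OF U] and V' = chart_in_atlas[OF V]
  let ?W = "U \<inter> F -` V"
  have "?W = U \<inter> {x \<in> topspace (topol M). F x \<in> V}"
    using openin_subset[OF chart_openin[OF M U']] by auto
  then have "openin (topol M) ?W"
    using openin_continuous_map_preimage[OF cont chart_openin[OF N V']] chart_openin[OF M U'] by (simp only: openin_Int)
  then have op: "open (\<phi> ` ?W)"
    by (rule chart_open_image_openin[OF M U']) simp
  have mem: "\<phi> p \<in> \<phi> ` ?W" using chart_mem[OF U] chart_mem[OF V] by simp
  have "F (inv_into U \<phi> x) \<in> V" if "x \<in> \<phi> ` ?W" for x
    using that by (auto simp: chart_inj[OF M U'])
  with op mem show "\<forall>\<^sub>F x in nhds (\<phi> p). F (inv_into U \<phi> x) \<in> V"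
    unfolding eventually_nhds by blast
  have "\<forall>(U, \<phi>)\<in>atlas M. \<forall>(V, \<psi>)\<in>atlas N. smooth_on (\<psi> \<circ> F \<circ> inv_into U \<phi>) (\<phi> ` (U \<inter> F -` V))"
    using F unfolding smooth_map_def by (elim conjE)
  from bspec[OF bspec[OF this U', simplified split] V']
  have "smooth_on (\<psi> \<circ> F \<circ> inv_into U \<phi>) (\<phi> ` ?W)" by simp
  then show "(\<psi> \<circ> F \<circ> inv_into U \<phi>) differentiable (at (\<phi> p))"
    using mem by (rule smooth_on_differentiable)
qed

section \<open>Maps of two variables\<close>

text \<open>
  Joint differentiability at \<open>(p, q)\<close>, expressed in pairs of charts. Tangent vectors of the product
  manifold, which would be families indexed by product charts, are thereby avoided.
\<close>

definition diff2_at ::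
  "('m, 'e::real_normed_vector) manifold \<Rightarrow> ('n, 'f::real_normed_vector) manifold
     \<Rightarrow> ('k, 'h::real_normed_vector) manifold \<Rightarrow> ('m \<times> 'n \<Rightarrow> 'k) \<Rightarrow> 'm \<Rightarrow> 'n \<Rightarrow> bool" where
  "diff2_at M N P F p q \<longleftrightarrow>
     p \<in> topspace (topol M) \<and> q \<in> topspace (topol N) \<and> F (p, q) \<in> topspace (topol P) \<and>
     (\<forall>U \<phi> V \<psi> W \<eta>. (U, \<phi>) \<in> charts_at M p \<longrightarrow> (V, \<psi>) \<in> charts_at N q \<longrightarrow>
        (W, \<eta>) \<in> charts_at P (F (p, q)) \<longrightarrow>
        (\<forall>\<^sub>F z in nhds (\<phi> p, \<psi> q). F (inv_into U \<phi> (fst z), inv_into V \<psi> (snd z)) \<in> W) \<and>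
        (\<lambda>z. \<eta> (F (inv_into U \<phi> (fst z), inv_into V \<psi> (snd z)))) differentiable (at (\<phi> p, \<psi> q)))"

lemma inv_into_map_prod:
  assumes "inj_on \<phi> U" and "inj_on \<psi> V" and "z \<in> \<phi> ` U \<times> \<psi> ` V"
  shows "inv_into (U \<times> V) (map_prod \<phi> \<psi>) z = (inv_into U \<phi> (fst z), inv_into V \<psi> (snd z))"
proof -
  obtain x y where z: "z = map_prod \<phi> \<psi> (x, y)" "x \<in> U" "y \<in> V" using assms(3) by auto
  then show ?thesis
    using inv_into_f_f[OF map_prod_inj_on[OF assms(1,2)], of "(x, y)"] assms(1,2) by simp
qed

text \<open>
  Basic open sets of the product topology are boxes, and charts map open sets to open sets.
\<close>

lemma eventually_prod_chart:
  assumes M: "smooth_manifold M" and N: "smooth_manifold N"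
    and U: "(U, \<phi>) \<in> charts_at M p" and V: "(V, \<psi>) \<in> charts_at N q"
    and W: "openin (prod_topology (topol M) (topol N)) W" and mem: "(p, q) \<in> W"
  shows "\<forall>\<^sub>F z in nhds (\<phi> p, \<psi> q).
    z \<in> \<phi> ` U \<times> \<psi> ` V \<and> (inv_into U \<phi> (fst z), inv_into V \<psi> (snd z)) \<in> W"
proof -
  note U' = chart_in_atlas[OF U] and V' = chart_in_atlas[OF V]
  obtain A B where A: "openin (topol M) A" "p \<in> A" and B: "openin (topol N) B" "q \<in> B"
    and sub: "A \<times> B \<subseteq> W"
    using W mem unfolding openin_prod_topology_alt by meson
  let ?O = "\<phi> ` (U \<inter> A) \<times> \<psi> ` (V \<inter> B)"
  have "open ?O"
    by (intro open_Times chart_open_image_openin[OF M U'] chart_open_image_openin[OF N V'] openin_Int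
        chart_openin[OF M U'] chart_openin[OF N V'] A B) auto
  moreover have "(\<phi> p, \<psi> q) \<in> ?O"
    using A B chart_mem[OF U] chart_mem[OF V] by auto
  moreover have "z \<in> \<phi> ` U \<times> \<psi> ` V \<and> (inv_into U \<phi> (fst z), inv_into V \<psi> (snd z)) \<in> W"
    if "z \<in> ?O" for z
    using that sub by (auto simp: chart_inj[OF M U'] chart_inj[OF N V'])
  ultimately show ?thesis unfolding eventually_nhds by blast
qed

lemma prod_chart_differentiable:
  assumes M: "smooth_manifold M" and N: "smooth_manifold N"
    and U: "(U, \<phi>) \<in> charts_at M p" and V: "(V, \<psi>) \<in> charts_at N q"
    and h: "(h \<circ> inv_into (U \<times> V) (map_prod \<phi> \<psi>)) differentiable (at (\<phi> p, \<psi> q))"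
  shows "(\<lambda>z. h (inv_into U \<phi> (fst z), inv_into V \<psi> (snd z))) differentiable (at (\<phi> p, \<psi> q))"
proof (rule differentiable_eventually[OF h])
  note U' = chart_in_atlas[OF U] and V' = chart_in_atlas[OF V]
  have "openin (prod_topology (topol M) (topol N)) (U \<times> V)"
    by (simp add: openin_prod_Times_iff chart_openin[OF M U'] chart_openin[OF N V'])
  then have "\<forall>\<^sub>F z in nhds (\<phi> p, \<psi> q). z \<in> \<phi> ` U \<times> \<psi> ` V \<and>
      (inv_into U \<phi> (fst z), inv_into V \<psi> (snd z)) \<in> U \<times> V"
    by (rule eventually_prod_chart[OF M N U V]) (use chart_mem[OF U] chart_mem[OF V] in simp)
  then show "\<forall>\<^sub>F z in nhds (\<phi> p, \<psi> q). (h \<circ> inv_into (U \<times> V) (map_prod \<phi> \<psi>)) z =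
      h (inv_into U \<phi> (fst z), inv_into V \<psi> (snd z))"
    by eventually_elim
      (simp only: comp_apply inv_into_map_prod[OF chart_inj[OF M U'] chart_inj[OF N V']])
qed

lemma prod_chart_in_atlas:
  "(U, \<phi>) \<in> atlas M \<Longrightarrow> (V, \<psi>) \<in> atlas N \<Longrightarrow> (U \<times> V, map_prod \<phi> \<psi>) \<in> atlas (prod_manifold M N)"
  by (auto simp: prod_manifold_def)

lemma smooth_map_diff2_at:
  assumes M: "smooth_manifold M" and N: "smooth_manifold N" and P: "smooth_manifold P"
    and F: "smooth_map (prod_manifold M N) P F"
    and p: "p \<in> topspace (topol M)" and q: "q \<in> topspace (topol N)"
  shows "diff2_at M N P F p q"
  unfolding diff2_at_def
proof (intro conjI allI impI)
  have cont: "continuous_map (prod_topology (topol M) (topol N)) (topol P) F"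
    using F by (simp add: smooth_map_def prod_manifold_def)
  with p q show "p \<in> topspace (topol M)" "q \<in> topspace (topol N)" "F (p, q) \<in> topspace (topol P)"
    by (auto simp: continuous_map_def)
  fix U \<phi> V \<psi> W \<eta>
  assume U: "(U, \<phi>) \<in> charts_at M p" and V: "(V, \<psi>) \<in> charts_at N q"
    and W: "(W, \<eta>) \<in> charts_at P (F (p, q))"
  note U' = chart_in_atlas[OF U] and V' = chart_in_atlas[OF V] and W' = chart_in_atlas[OF W]
  have "openin (prod_topology (topol M) (topol N))
      {z \<in> topspace (prod_topology (topol M) (topol N)). F z \<in> W}"
    by (rule openin_continuous_map_preimage[OF cont chart_openin[OF P W']])
  then have "\<forall>\<^sub>F z in nhds (\<phi> p, \<psi> q). z \<in> \<phi> ` U \<times> \<psi> ` V \<and>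
      (inv_into U \<phi> (fst z), inv_into V \<psi> (snd z)) \<in>
        {z \<in> topspace (prod_topology (topol M) (topol N)). F z \<in> W}"
    by (rule eventually_prod_chart[OF M N U V]) (use p q chart_mem[OF W] in simp)
  then show "\<forall>\<^sub>F z in nhds (\<phi> p, \<psi> q). F (inv_into U \<phi> (fst z), inv_into V \<psi> (snd z)) \<in> W"
    by eventually_elim simp
  have "\<forall>(A, \<alpha>)\<in>atlas (prod_manifold M N). \<forall>(B, \<beta>)\<in>atlas P.
      smooth_on (\<beta> \<circ> F \<circ> inv_into A \<alpha>) (\<alpha> ` (A \<inter> F -` B))"
    using F unfolding smooth_map_def by (elim conjE)
  from bspec[OF bspec[OF this prod_chart_in_atlas[OF U' V'], simplified split] W']
  have "smooth_on (\<eta> \<circ> F \<circ> inv_into (U \<times> V) (map_prod \<phi> \<psi>)) (map_prod \<phi> \<psi> ` ((U \<times> V) \<inter> F -` W))"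
    by simp
  moreover have "(\<phi> p, \<psi> q) \<in> map_prod \<phi> \<psi> ` ((U \<times> V) \<inter> F -` W)"
    using chart_mem[OF U] chart_mem[OF V] chart_mem[OF W] by (auto intro!: image_eqI[of _ _ "(p, q)"])
  ultimately have "((\<eta> \<circ> F) \<circ> inv_into (U \<times> V) (map_prod \<phi> \<psi>)) differentiable (at (\<phi> p, \<psi> q))"
    by (rule smooth_on_differentiable)
  from prod_chart_differentiable[OF M N U V this]
  show "(\<lambda>z. \<eta> (F (inv_into U \<phi> (fst z), inv_into V \<psi> (snd z)))) differentiable (at (\<phi> p, \<psi> q))"
    by simp
qed

context
  fixes M :: "('m, 'e::real_normed_vector) manifold" and N :: "('n, 'f::real_normed_vector) manifold"
    and P :: "('k, 'h::real_normed_vector) manifold" and F :: "'m \<times> 'n \<Rightarrow> 'k" and p q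
  assumes M: "smooth_manifold M" and N: "smooth_manifold N" and F: "diff2_at M N P F p q"
begin

lemma diff2_atD:
  shows "p \<in> topspace (topol M)" and "q \<in> topspace (topol N)" and "F (p, q) \<in> topspace (topol P)"
    and "(U, \<phi>) \<in> charts_at M p \<Longrightarrow> (V, \<psi>) \<in> charts_at N q \<Longrightarrow> (W, \<eta>) \<in> charts_at P (F (p, q)) \<Longrightarrow>
      \<forall>\<^sub>F z in nhds (\<phi> p, \<psi> q). F (inv_into U \<phi> (fst z), inv_into V \<psi> (snd z)) \<in> W"
    and "(U, \<phi>) \<in> charts_at M p \<Longrightarrow> (V, \<psi>) \<in> charts_at N q \<Longrightarrow> (W, \<eta>) \<in> charts_at P (F (p, q)) \<Longrightarrow>
      (\<lambda>z. \<eta> (F (inv_into U \<phi> (fst z), inv_into V \<psi> (snd z)))) differentiable (at (\<phi> p, \<psi> q))"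
  using F unfolding diff2_at_def by blast+

text \<open>
  Partial derivatives are the restrictions of the total derivative to the two factors.
\<close>

lemma slice_derivatives:
  assumes U: "(U, \<phi>) \<in> charts_at M p" and V: "(V, \<psi>) \<in> charts_at N q"
    and D: "((\<lambda>z. h (F (inv_into U \<phi> (fst z), inv_into V \<psi> (snd z)))) has_derivative D) (at (\<phi> p, \<psi> q))"
  shows "((h \<circ> (\<lambda>x. F (x, q)) \<circ> inv_into U \<phi>) has_derivative (\<lambda>v. D (v, 0))) (at (\<phi> p))"
    and "((h \<circ> (\<lambda>y. F (p, y)) \<circ> inv_into V \<psi>) has_derivative (\<lambda>w. D (0, w))) (at (\<psi> q))"
proof -
  have inv: "inv_into U \<phi> (\<phi> p) = p" "inv_into V \<psi> (\<psi> q) = q"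
    by (simp_all add: chart_inj[OF M chart_in_atlas[OF U]] chart_mem[OF U]
        chart_inj[OF N chart_in_atlas[OF V]] chart_mem[OF V])
  have "((\<lambda>x. (x, \<psi> q)) has_derivative (\<lambda>v. (v, 0))) (at (\<phi> p))"
    by (auto intro!: derivative_eq_intros)
  from has_derivative_compose[OF this D]
  show "((h \<circ> (\<lambda>x. F (x, q)) \<circ> inv_into U \<phi>) has_derivative (\<lambda>v. D (v, 0))) (at (\<phi> p))"
    by (simp add: inv comp_def)
  have "((\<lambda>y. (\<phi> p, y)) has_derivative (\<lambda>w. (0, w))) (at (\<psi> q))"
    by (auto intro!: derivative_eq_intros)
  from has_derivative_compose[OF this D]
  show "((h \<circ> (\<lambda>y. F (p, y)) \<circ> inv_into V \<psi>) has_derivative (\<lambda>w. D (0, w))) (at (\<psi> q))"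
    by (simp add: inv comp_def)
qed

lemma
  shows diff2_at_fst: "diff_at M P (\<lambda>x. F (x, q)) p"
    and diff2_at_snd: "diff_at N P (\<lambda>y. F (p, y)) q"
proof -
  obtain U0 \<phi>0 where U0: "(U0, \<phi>0) \<in> charts_at M p" using charts_at_nonempty[OF M diff2_atD(1)] .
  obtain V0 \<psi>0 where V0: "(V0, \<psi>0) \<in> charts_at N q" using charts_at_nonempty[OF N diff2_atD(2)] .
  have invU: "inv_into U0 \<phi>0 (\<phi>0 p) = p" and invV: "inv_into V0 \<psi>0 (\<psi>0 q) = q"
    by (simp_all add: chart_inj[OF M chart_in_atlas[OF U0]] chart_mem[OF U0]
        chart_inj[OF N chart_in_atlas[OF V0]] chart_mem[OF V0])
  show "diff_at M P (\<lambda>x. F (x, q)) p"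
    unfolding diff_at_def
  proof (intro conjI allI impI diff2_atD)
    fix U \<phi> W \<eta> assume U: "(U, \<phi>) \<in> charts_at M p" and W: "(W, \<eta>) \<in> charts_at P (F (p, q))"
    have "(\<lambda>x. (x, \<psi>0 q)) differentiable (at (\<phi> p))" by simp
    from differentiable_nhds[OF this, OF diff2_atD(4)[OF U V0 W]]
    show "\<forall>\<^sub>F x in nhds (\<phi> p). F (inv_into U \<phi> x, q) \<in> W" by (simp add: invV)
    show "(\<eta> \<circ> (\<lambda>x. F (x, q)) \<circ> inv_into U \<phi>) differentiable (at (\<phi> p))"
      using slice_derivatives(1)[OF U V0] diff2_atD(5)[OF U V0 W] unfolding differentiable_def by blast
  qed
  show "diff_at N P (\<lambda>y. F (p, y)) q"
    unfolding diff_at_def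
  proof (intro conjI allI impI diff2_atD)
    fix V \<psi> W \<eta> assume V: "(V, \<psi>) \<in> charts_at N q" and W: "(W, \<eta>) \<in> charts_at P (F (p, q))"
    have "(\<lambda>y. (\<phi>0 p, y)) differentiable (at (\<psi> q))" by simp
    from differentiable_nhds[OF this, OF diff2_atD(4)[OF U0 V W]]
    show "\<forall>\<^sub>F y in nhds (\<psi> q). F (p, inv_into V \<psi> y) \<in> W" by (simp add: invU)
    show "(\<eta> \<circ> (\<lambda>y. F (p, y)) \<circ> inv_into V \<psi>) differentiable (at (\<psi> q))"
      using slice_derivatives(2)[OF U0 V] diff2_atD(5)[OF U0 V W] unfolding differentiable_def by blast
  qed
qed

text \<open>
  The product rule. It is the additivity of the total derivative on \<open>(v, w) = (v, 0) + (0, w)\<close>.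
\<close>

lemma has_velocity_diff2:
  assumes a: "has_velocity M a p v" and b: "has_velocity N b q w"
  shows "has_velocity P (\<lambda>t. F (a t, b t)) (F (p, q))
    (\<lambda>c. tangent_map M P (\<lambda>x. F (x, q)) p v c + tangent_map N P (\<lambda>y. F (p, y)) q w c)"
proof (rule has_velocityI)
  note a' = has_velocityD[OF a] and b' = has_velocityD[OF b]
  show "F (a 0, b 0) = F (p, q)" and "F (p, q) \<in> topspace (topol P)"
    using a'(1) b'(1) diff2_atD(3) by simp_all
  show "tangent_map M P (\<lambda>x. F (x, q)) p v x + tangent_map N P (\<lambda>y. F (p, y)) q w x = 0"
    if "x \<notin> charts_at P (F (p, q))" for x
    using that by (simp add: tangent_map_outside)
  obtain U \<phi> where someU: "(SOME c. c \<in> charts_at M p) = (U, \<phi>)" by fastforce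
  then have U: "(U, \<phi>) \<in> charts_at M p" using some_chart[OF M diff2_atD(1)] by simp
  obtain V \<psi> where someV: "(SOME c. c \<in> charts_at N q) = (V, \<psi>)" by fastforce
  then have V: "(V, \<psi>) \<in> charts_at N q" using some_chart[OF N diff2_atD(2)] by simp
  have inv: "inv_into U \<phi> (\<phi> (a t)) = a t" if "a t \<in> U" for t
    using that by (simp add: chart_inj[OF M chart_in_atlas[OF U]])
  have inv': "inv_into V \<psi> (\<psi> (b t)) = b t" if "b t \<in> V" for t
    using that by (simp add: chart_inj[OF N chart_in_atlas[OF V]])
  let ?c = "\<lambda>t. (\<phi> (a t), \<psi> (b t))"
  have deriv: "(?c has_vector_derivative (v (U, \<phi>), w (V, \<psi>))) (at 0)"
    by (rule has_vector_derivative_Pair[OF a'(5)[OF U] b'(5)[OF V]])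
  have ev: "\<forall>\<^sub>F t in nhds 0. a t \<in> U \<and> b t \<in> V"
    using a'(4)[OF U] b'(4)[OF V] by eventually_elim simp
  fix W \<eta> assume W: "(W, \<eta>) \<in> charts_at P (F (p, q))"
  let ?h = "\<lambda>z. \<eta> (F (inv_into U \<phi> (fst z), inv_into V \<psi> (snd z)))"
  let ?D = "frechet_derivative ?h (at (\<phi> p, \<psi> q))"
  have "\<forall>\<^sub>F z in nhds (?c 0). F (inv_into U \<phi> (fst z), inv_into V \<psi> (snd z)) \<in> W"
    using diff2_atD(4)[OF U V W] by (simp only: a'(1) b'(1))
  from has_vector_derivative_nhds[OF deriv this] ev
  show "\<forall>\<^sub>F t in nhds 0. F (a t, b t) \<in> W"
    by eventually_elim (simp add: inv inv')
  have D: "(?h has_derivative ?D) (at (\<phi> p, \<psi> q))"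
    using diff2_atD(5)[OF U V W] by (simp only: frechet_derivative_works)
  have "tangent_map M P (\<lambda>x. F (x, q)) p v (W, \<eta>) = ?D (v (U, \<phi>), 0)"
    using frechet_derivative_at[OF slice_derivatives(1)[OF U V D]]
    by (simp add: tangent_map_chart W someU fun_eq_iff)
  moreover have "tangent_map N P (\<lambda>y. F (p, y)) q w (W, \<eta>) = ?D (0, w (V, \<psi>))"
    using frechet_derivative_at[OF slice_derivatives(2)[OF U V D]]
    by (simp add: tangent_map_chart W someV fun_eq_iff)
  moreover have "?D (v (U, \<phi>), w (V, \<psi>)) = ?D (v (U, \<phi>), 0) + ?D (0, w (V, \<psi>))"
    using linear_add[OF has_derivative_linear[OF D], of "(v (U, \<phi>), 0)" "(0, w (V, \<psi>))"] by simp
  ultimately have eq: "?D (v (U, \<phi>), w (V, \<psi>)) =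
    tangent_map M P (\<lambda>x. F (x, q)) p v (W, \<eta>) + tangent_map N P (\<lambda>y. F (p, y)) q w (W, \<eta>)" by simp
  have "?h differentiable (at (?c 0))"
    using diff2_atD(5)[OF U V W] by (simp only: a'(1) b'(1))
  from has_vector_derivative_compose_frechet[OF deriv this]
  have "((\<lambda>t. ?h (?c t)) has_vector_derivative ?D (v (U, \<phi>), w (V, \<psi>))) (at 0)"
    by (simp only: a'(1) b'(1))
  then have "((\<lambda>t. \<eta> (F (a t, b t))) has_vector_derivative ?D (v (U, \<phi>), w (V, \<psi>))) (at 0)"
    by (rule has_vector_derivative_eventually) (use ev in eventually_elim, simp add: inv inv')
  then show "((\<lambda>t. \<eta> (F (a t, b t))) has_vector_derivative
      tangent_map M P (\<lambda>x. F (x, q)) p v (W, \<eta>) + tangent_map N P (\<lambda>y. F (p, y)) q w (W, \<eta>)) (at 0)"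
    by (simp only: eq)
qed

end

section \<open>Real-valued functions\<close>

text \<open>
  Treating \<open>\<real>\<close> as a manifold makes differentials of functions a special case of tangent maps.
\<close>

abbreviation real_line :: "(real, real) manifold" where
  "real_line \<equiv> open_submanifold UNIV"

lemma charts_at_real_line: "charts_at real_line x = {(UNIV, \<lambda>x. x)}"
  by (auto simp: charts_at_def open_submanifold_def)

lemma topspace_real_line: "topspace (topol real_line) = UNIV"
  by (simp add: open_submanifold_def)

lemma has_velocity_real_line:
  assumes "has_velocity real_line c x v"
  shows "(c has_real_derivative v (UNIV, \<lambda>x. x)) (at 0)"
  using has_velocityD(5)[OF assms, of UNIV "\<lambda>x. x"]
  by (simp add: charts_at_real_line has_real_derivative_iff_has_vector_derivative)

lemma differential_eq_tangent_map:
  "differential M F p v = tangent_map M real_line F p v (UNIV, \<lambda>x. x)"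
  by (simp add: differential_def tangent_map_def charts_at_real_line comp_def)

lemma differential_along_curve:
  assumes "smooth_manifold M" and "diff_at M real_line F p" and "has_velocity M c p v"
  shows "((\<lambda>t. F (c t)) has_real_derivative differential M F p v) (at 0)"
  using has_velocity_real_line[OF has_velocity_tangent_map[OF assms]]
  by (simp add: differential_eq_tangent_map)

lemma differential_along_curve2:
  assumes "smooth_manifold M" and "diff2_at M M real_line F p q"
    and "has_velocity M a p v" and "has_velocity M b q w"
  shows "((\<lambda>t. F (a t, b t)) has_real_derivative D1 M F (p, q) v + D2 M F (p, q) w) (at 0)"
  using has_velocity_real_line[OF has_velocity_diff2[OF assms(1,1,2-)]]
  by (simp add: differential_eq_tangent_map D1_def D2_def)

lemma differentiable_fun_diff2_at:
  assumes M: "smooth_manifold M" and N: "smooth_manifold N"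
    and F: "differentiable_fun (prod_manifold M N) F"
    and "p \<in> topspace (topol M)" and "q \<in> topspace (topol N)"
  shows "diff2_at M N real_line F p q"
  unfolding diff2_at_def charts_at_real_line topspace_real_line
proof (intro conjI allI impI assms UNIV_I)
  fix U \<phi> V \<psi> and W :: "real set" and \<eta> :: "real \<Rightarrow> real"
  assume U: "(U, \<phi>) \<in> charts_at M p" and V: "(V, \<psi>) \<in> charts_at N q" and "(W, \<eta>) \<in> {(UNIV, \<lambda>x. x)}"
  then have W: "W = UNIV" "\<eta> = (\<lambda>x. x)" by simp_all
  then show "\<forall>\<^sub>F z in nhds (\<phi> p, \<psi> q). F (inv_into U \<phi> (fst z), inv_into V \<psi> (snd z)) \<in> W" by simp
  have "\<forall>x\<in>U \<times> V. (F \<circ> inv_into (U \<times> V) (map_prod \<phi> \<psi>)) differentiable (at (map_prod \<phi> \<psi> x))"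
    using bspec[OF F[unfolded differentiable_fun_def]
        prod_chart_in_atlas[OF chart_in_atlas[OF U] chart_in_atlas[OF V]]] by simp
  from bspec[OF this, of "(p, q)"]
  have "(F \<circ> inv_into (U \<times> V) (map_prod \<phi> \<psi>)) differentiable (at (\<phi> p, \<psi> q))"
    using chart_mem[OF U] chart_mem[OF V] by simp
  from prod_chart_differentiable[OF M N U V this]
  show "(\<lambda>z. \<eta> (F (inv_into U \<phi> (fst z), inv_into V \<psi> (snd z)))) differentiable (at (\<phi> p, \<psi> q))"
    by (simp add: W)
qed

section \<open>Right translation and the reduced variation\<close>

context lie_group
begin

lemma in_carrier_iff: "p \<in> carrier G \<longleftrightarrow> p \<in> topspace (topol M)"
  by (simp add: topspace_eq_carrier)

lemma curve_exists:
  assumes "p \<in> carrier G" and "v \<in> tangent_space M p"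
  shows "\<exists>c. smooth_curve M c \<and> has_velocity M c p v"
  using tangent_vector_has_curve[OF manifold _ assms(2)] assms(1) by (metis in_carrier_iff)

lemma mult_diff2_at:
  "p \<in> carrier G \<Longrightarrow> q \<in> carrier G \<Longrightarrow> diff2_at M M M (\<lambda>(x, y). x \<otimes> y) p q"
  by (rule smooth_map_diff2_at[OF manifold manifold manifold smooth_mult]) (simp_all add: topspace_eq_carrier)

lemma right_translation_diff_at:
  "p \<in> carrier G \<Longrightarrow> f \<in> carrier G \<Longrightarrow> diff_at M M (\<lambda>x. x \<otimes> f) p"
  using diff2_at_fst[OF manifold manifold mult_diff2_at] by simp

lemma left_translation_diff_at:
  "p \<in> carrier G \<Longrightarrow> f \<in> carrier G \<Longrightarrow> diff_at M M (\<lambda>y. f \<otimes> y) p"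
  using diff2_at_snd[OF manifold manifold mult_diff2_at] by simp

lemma inversion_diff_at: "p \<in> carrier G \<Longrightarrow> diff_at M M (\<lambda>x. inv x) p"
  using smooth_map_diff_at[OF manifold manifold smooth_inv] by (simp add: in_carrier_iff)

lemma conjugation_diff_at:
  assumes "f \<in> carrier G" and "p \<in> carrier G"
  shows "diff_at M M (\<lambda>h. f \<otimes> h \<otimes> inv f) p"
  by (rule diff_at_compose[OF manifold manifold left_translation_diff_at right_translation_diff_at])
    (use assms in simp_all)

lemma eventually_in_carrier:
  "has_velocity M c p v \<Longrightarrow> \<forall>\<^sub>F t in nhds 0. c t \<in> carrier G"
  using has_velocity_eventually_carrier[OF manifold] by (simp add: topspace_eq_carrier)

lemma has_velocity_in_carrier: "has_velocity M c p v \<Longrightarrow> p \<in> carrier G"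
  using has_velocityD(2) by (simp add: in_carrier_iff)

lemma has_velocity_TR:
  assumes "has_velocity M c p v" and "f \<in> carrier G"
  shows "has_velocity M (\<lambda>t. c t \<otimes> f) (p \<otimes> f) (TR G M f p v)"
  unfolding TR_def
  by (rule has_velocity_tangent_map[OF manifold right_translation_diff_at])
    (use assms has_velocity_in_carrier in auto)

lemma has_velocity_Ad:
  assumes "has_velocity M c \<one> v" and "f \<in> carrier G"
  shows "has_velocity M (\<lambda>t. f \<otimes> c t \<otimes> inv f) \<one> (Ad G M f v)"
  using has_velocity_tangent_map[OF manifold conjugation_diff_at[OF assms(2) one_closed] assms(1)] assms(2)
  by (simp add: Ad_def)

lemma has_velocity_mult:
  assumes "has_velocity M a p v" and "has_velocity M b q w"
  shows "has_velocity M (\<lambda>t. a t \<otimes> b t) (p \<otimes> q)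
    (\<lambda>c. TR G M q p v c + tangent_map M M (\<lambda>y. p \<otimes> y) q w c)"
  using has_velocity_diff2[OF manifold manifold mult_diff2_at assms] has_velocity_in_carrier[OF assms(1)]
    has_velocity_in_carrier[OF assms(2)] by (simp add: TR_def)

lemma TR_diff:
  "p \<in> carrier G \<Longrightarrow> f \<in> carrier G \<Longrightarrow> TR G M f p (v - w) = TR G M f p v - TR G M f p w"
  unfolding TR_def by (rule tangent_map_diff[OF manifold right_translation_diff_at])

lemma TR_tangent:
  assumes "p \<in> carrier G" and "f \<in> carrier G" and "v \<in> tangent_space M p"
  shows "TR G M f p v \<in> tangent_space M (p \<otimes> f)"
proof -
  obtain c where "has_velocity M c p v"
    using curve_exists[OF assms(1,3)] by blast
  from has_velocity_tangent[OF manifold has_velocity_TR[OF this assms(2)]] show ?thesis .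
qed

lemma TR_TR:
  assumes p: "p \<in> carrier G" and f: "f \<in> carrier G" and h: "h \<in> carrier G" and v: "v \<in> tangent_space M p"
  shows "TR G M h (p \<otimes> f) (TR G M f p v) = TR G M (f \<otimes> h) p v"
proof -
  obtain c where c: "has_velocity M c p v"
    using curve_exists[OF p v] by blast
  have "\<forall>\<^sub>F t in nhds 0. c t \<otimes> f \<otimes> h = c t \<otimes> (f \<otimes> h)"
    using eventually_in_carrier[OF c] by eventually_elim (simp add: m_assoc f h)
  from has_velocity_cong[OF has_velocity_TR[OF has_velocity_TR[OF c f] h] this]
  show ?thesis
    using has_velocity_TR[OF c, of "f \<otimes> h"] f h p m_assoc[OF p f h] has_velocity_unique by fastforce
qed

lemma TR_one:
  assumes p: "p \<in> carrier G" and v: "v \<in> tangent_space M p"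
  shows "TR G M \<one> p v = v"
proof -
  obtain c where c: "has_velocity M c p v"
    using curve_exists[OF p v] by blast
  have "\<forall>\<^sub>F t in nhds 0. c t \<otimes> \<one> = c t"
    using eventually_in_carrier[OF c] by eventually_elim simp
  from has_velocity_cong[OF has_velocity_TR[OF c one_closed] this]
  show ?thesis using p c has_velocity_unique by fastforce
qed

lemma TR_zero:
  assumes "p \<in> carrier G" and "f \<in> carrier G"
  shows "TR G M f p zero_tvec = zero_tvec"
  unfolding TR_def by (rule tangent_map_zero[OF manifold right_translation_diff_at[OF assms]])

lemma Ad_zero: "f \<in> carrier G \<Longrightarrow> Ad G M f zero_tvec = zero_tvec"
  unfolding Ad_def by (rule tangent_map_zero[OF manifold conjugation_diff_at]) simp_all

text \<open>
  With \<open>u t = b t \<otimes> inv q\<close>, a curve through \<open>\<one>\<close>, the curve in question is \<open>f \<otimes> inv (u t)\<close>. Differentiate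
  the constant curve \<open>(f \<otimes> u t \<otimes> inv f) \<otimes> (f \<otimes> inv (u t)) = f\<close> by the product rule: the first factor has
  velocity \<open>Ad\<^sub>f u'\<close> at \<open>\<one>\<close> and contributes \<open>TR\<^sub>f (Ad\<^sub>f u')\<close>, the second contributes its own velocity, so
  the two cancel. In this way the derivative of the inversion is never computed.
\<close>

lemma has_velocity_quotient_snd:
  assumes p: "p \<in> carrier G" and b: "has_velocity M b q w"
  defines "f \<equiv> p \<otimes> inv q"
  shows "has_velocity M (\<lambda>t. p \<otimes> inv (b t)) f
    (\<lambda>c. - TR G M f \<one> (Ad G M f (TR G M (inv q) q w)) c)"
proof -
  have q: "q \<in> carrier G" by (rule has_velocity_in_carrier[OF b])
  have f: "f \<in> carrier G" by (simp add: f_def p q)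
  from has_velocity_tangent_map[OF manifold inversion_diff_at[OF q] b]
  have "has_velocity M (\<lambda>t. inv (b t)) (inv q) (tangent_map M M (\<lambda>x. inv x) q w)" .
  from has_velocity_tangent_map[OF manifold left_translation_diff_at this, of p]
  obtain z where z: "has_velocity M (\<lambda>t. p \<otimes> inv (b t)) f z"
    unfolding f_def using p q by auto
  have "has_velocity M (\<lambda>t. b t \<otimes> inv q) \<one> (TR G M (inv q) q w)"
    using has_velocity_TR[OF b, of "inv q"] q by simp
  note conj = has_velocity_Ad[OF this f]
  have left_one: "tangent_map M M (\<lambda>y. \<one> \<otimes> y) f z = z"
  proof -
    have "\<forall>\<^sub>F t in nhds 0. \<one> \<otimes> (p \<otimes> inv (b t)) = p \<otimes> inv (b t)"
      using eventually_in_carrier[OF b] by eventually_elim (simp add: p)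
    from has_velocity_cong[OF has_velocity_tangent_map[OF manifold left_translation_diff_at[OF f one_closed] z] this]
    show ?thesis using z f has_velocity_unique by fastforce
  qed
  have "\<forall>\<^sub>F t in nhds 0. (f \<otimes> (b t \<otimes> inv q) \<otimes> inv f) \<otimes> (p \<otimes> inv (b t)) = f"
    using eventually_in_carrier[OF b]
  proof eventually_elim
    case (elim t)
    have "inv f \<otimes> p = q" by (simp add: f_def p q inv_mult_group m_assoc)
    then have "(f \<otimes> (b t \<otimes> inv q) \<otimes> inv f) \<otimes> (p \<otimes> inv (b t)) = f \<otimes> (b t \<otimes> (inv q \<otimes> q)) \<otimes> inv (b t)"
      using f p q elim by (simp add: m_assoc) (simp flip: m_assoc)
    also have "\<dots> = f" using f q elim by (simp add: m_assoc)
    finally show ?case .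
  qed
  from has_velocity_cong[OF has_velocity_mult[OF conj z] this]
  have "has_velocity M (\<lambda>_. f) f
      (\<lambda>c. TR G M f \<one> (Ad G M f (TR G M (inv q) q w)) c + tangent_map M M (\<lambda>y. \<one> \<otimes> y) f z c)"
    using f by simp
  moreover have "has_velocity M (\<lambda>_. f) f zero_tvec"
    using f by (simp add: has_velocity_const in_carrier_iff)
  ultimately have "(\<lambda>c. TR G M f \<one> (Ad G M f (TR G M (inv q) q w)) c + z c) = zero_tvec"
    unfolding left_one by (rule has_velocity_unique)
  then have "z = (\<lambda>c. - TR G M f \<one> (Ad G M f (TR G M (inv q) q w)) c)"
    by (auto simp: zero_tvec_def fun_eq_iff add_eq_0_iff)
  with z show ?thesis by simp
qed

text \<open>
  The formula for the induced variation. By the product rule the two factors contribute separately.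
  The first contributes the right translate of \<open>v\<close> by \<open>inv q\<close>, and translating by \<open>inv q\<close> is translating by \<open>inv p\<close> and then by
  \<open>f\<close>; the second is \<open>has_velocity_quotient_snd\<close>.
\<close>

lemma has_velocity_quotient:
  assumes a: "has_velocity M a p v" and b: "has_velocity M b q w"
  defines "f \<equiv> p \<otimes> inv q"
  shows "has_velocity M (\<lambda>t. a t \<otimes> inv (b t)) f
    (TR G M f \<one> (TR G M (inv p) p v - Ad G M f (TR G M (inv q) q w)))"
proof -
  have p: "p \<in> carrier G" and q: "q \<in> carrier G"
    using has_velocity_in_carrier a b by blast+
  then have f: "f \<in> carrier G" by (simp add: f_def)
  define z where "z = (\<lambda>c. - TR G M f \<one> (Ad G M f (TR G M (inv q) q w)) c)"
  from has_velocity_tangent_map[OF manifold inversion_diff_at[OF q] b]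
  obtain w' where w': "has_velocity M (\<lambda>t. inv (b t)) (inv q) w'" by blast
  from has_velocity_tangent_map[OF manifold left_translation_diff_at this, of p]
  have "has_velocity M (\<lambda>t. p \<otimes> inv (b t)) f (tangent_map M M (\<lambda>y. p \<otimes> y) (inv q) w')"
    using p q by (simp add: f_def)
  moreover have "has_velocity M (\<lambda>t. p \<otimes> inv (b t)) f z"
    unfolding z_def f_def by (rule has_velocity_quotient_snd[OF p b])
  ultimately have z: "tangent_map M M (\<lambda>y. p \<otimes> y) (inv q) w' = z"
    by (rule has_velocity_unique)
  have "inv p \<otimes> f = inv q"
    using p q by (simp add: f_def flip: m_assoc)
  then have "TR G M (inv q) p v = TR G M f \<one> (TR G M (inv p) p v)"
    using TR_TR[OF p inv_closed[OF p] f has_velocity_tangent[OF manifold a]] p by simp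
  then have "(\<lambda>c. TR G M (inv q) p v c + z c) =
      TR G M f \<one> (TR G M (inv p) p v - Ad G M f (TR G M (inv q) q w))"
    by (simp add: z_def TR_diff f fun_eq_iff)
  with has_velocity_mult[OF a w'] show ?thesis
    by (simp add: z f_def)
qed

end

section \<open>Discrete variational principles\<close>

text \<open>
  A variational principle is a condition on the variations alone, provided that each of them is
  realized by curves and that the derivative of the functional depends on the curves only through
  their velocities.
\<close>

lemma extremal_for_iff_first_variation:
  assumes curves: "\<And>\<delta> i. \<delta> \<in> W \<Longrightarrow> i \<in> I \<Longrightarrow> \<exists>c. smooth_curve M c \<and> has_velocity M c (x i) (\<delta> i)"
    and M: "smooth_manifold M"
    and deriv: "\<And>\<delta> \<gamma>. \<delta> \<in> W \<Longrightarrow> (\<And>i. i \<in> I \<Longrightarrow> has_velocity M (\<gamma> i) (x i) (\<delta> i)) \<Longrightarrow>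
      ((\<lambda>\<epsilon>. S (\<lambda>i. \<gamma> i \<epsilon>)) has_real_derivative dS \<delta>) (at 0)"
  shows "extremal_for M I S x W \<longleftrightarrow> (\<forall>\<delta>\<in>W. dS \<delta> = 0)"
proof
  assume extremal: "extremal_for M I S x W"
  show "\<forall>\<delta>\<in>W. dS \<delta> = 0"
  proof
    fix \<delta> assume \<delta>: "\<delta> \<in> W"
    have "\<forall>i. \<exists>c. i \<in> I \<longrightarrow> smooth_curve M c \<and> has_velocity M c (x i) (\<delta> i)"
      using curves[OF \<delta>] by blast
    from choice[OF this] obtain \<gamma>
      where \<gamma>: "\<And>i. i \<in> I \<Longrightarrow> smooth_curve M (\<gamma> i)" "\<And>i. i \<in> I \<Longrightarrow> has_velocity M (\<gamma> i) (x i) (\<delta> i)"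
      by blast
    have "((\<lambda>\<epsilon>. S (\<lambda>i. \<gamma> i \<epsilon>)) has_real_derivative 0) (at 0)"
      using extremal \<delta> \<gamma> has_velocityD(1)[OF \<gamma>(2)] has_velocity_imp_velocity[OF \<gamma>(2)]
      unfolding extremal_for_def by blast
    with deriv[OF \<delta> \<gamma>(2)] show "dS \<delta> = 0" by (metis DERIV_unique)
  qed
next
  assume zero: "\<forall>\<delta>\<in>W. dS \<delta> = 0"
  show "extremal_for M I S x W"
    unfolding extremal_for_def
  proof (intro ballI allI impI)
    fix \<delta> \<gamma>
    assume \<delta>: "\<delta> \<in> W"
      and \<gamma>: "\<forall>i\<in>I. smooth_curve M (\<gamma> i) \<and> \<gamma> i 0 = x i \<and> velocity M (\<gamma> i) = \<delta> i"
    have "has_velocity M (\<gamma> i) (x i) (\<delta> i)" if "i \<in> I" for i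
      using smooth_curve_has_velocity[OF M, of "\<gamma> i"] bspec[OF \<gamma> that] by simp
    from deriv[OF \<delta> this] show "((\<lambda>\<epsilon>. S (\<lambda>i. \<gamma> i \<epsilon>)) has_real_derivative 0) (at 0)"
      using zero \<delta> by simp
  qed
qed

text \<open>
  Summation by parts and the discrete fundamental lemma of the calculus of variations: shift the index
  in the \<open>B\<close>-terms, where the boundary terms vanish because the variations do so at the end points, and test with
  variations supported at a single interior index.
\<close>

lemma sum_vanishes_iff_stationary:
  fixes A B :: "nat \<Rightarrow> ('m, 'e::real_normed_vector) tvec \<Rightarrow> real"
  assumes zero: "\<And>k. k < N \<Longrightarrow> A k zero_tvec = 0" "\<And>k. k < N \<Longrightarrow> B k zero_tvec = 0"
    and tangent_zero: "\<And>k. k \<le> N \<Longrightarrow> zero_tvec \<in> tangent_space M (g k)"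
  shows "(\<forall>\<delta>\<in>variations M N g. (\<Sum>k<N. A k (\<delta> k) + B k (\<delta> (Suc k))) = 0) \<longleftrightarrow>
    (\<forall>k\<in>{1..N-1}. \<forall>v\<in>tangent_space M (g k). B (k - 1) v + A k v = 0)"
proof -
  have parts: "(\<Sum>k<N. A k (\<delta> k) + B k (\<delta> (Suc k))) = (\<Sum>k\<in>{1..N-1}. B (k - 1) (\<delta> k) + A k (\<delta> k))"
    if \<delta>: "\<delta> \<in> variations M N g" for \<delta>
  proof (cases N)
    case (Suc n)
    have "(\<Sum>k<N. A k (\<delta> k)) = A 0 (\<delta> 0) + (\<Sum>k\<in>{1..n}. A k (\<delta> k))"
      by (simp add: Suc lessThan_Suc_atMost atMost_atLeast0 sum.atLeast_Suc_atMost)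
    moreover have "(\<Sum>k<N. B k (\<delta> (Suc k))) = B n (\<delta> N) + (\<Sum>k<n. B k (\<delta> (Suc k)))"
      by (simp add: Suc)
    moreover have "(\<Sum>k<n. B k (\<delta> (Suc k))) = (\<Sum>k\<in>{1..n}. B (k - 1) (\<delta> k))"
      using sum.atLeast1_atMost_eq[of "\<lambda>k. B (k - 1) (\<delta> k)" n] by simp
    ultimately show ?thesis
      using \<delta> zero by (simp add: variations_def Suc sum.distrib)
  qed simp
  show ?thesis
  proof
    assume vanish: "\<forall>\<delta>\<in>variations M N g. (\<Sum>k<N. A k (\<delta> k) + B k (\<delta> (Suc k))) = 0"
    show "\<forall>k\<in>{1..N-1}. \<forall>v\<in>tangent_space M (g k). B (k - 1) v + A k v = 0"
    proof (intro ballI)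
      fix k v assume k: "k \<in> {1..N-1}" and v: "v \<in> tangent_space M (g k)"
      let ?\<delta> = "\<lambda>i. if i = k then v else zero_tvec"
      have \<delta>: "?\<delta> \<in> variations M N g"
        using k v tangent_zero by (auto simp: variations_def)
      have "(\<Sum>i\<in>{1..N-1}. B (i - 1) (?\<delta> i) + A i (?\<delta> i)) =
          (\<Sum>i\<in>{1..N-1}. if i = k then B (k - 1) v + A k v else 0)"
        using k by (intro sum.cong) (auto simp: zero)
      also have "\<dots> = B (k - 1) v + A k v" using k by simp
      finally show "B (k - 1) v + A k v = 0"
        using bspec[OF vanish \<delta>] parts[OF \<delta>] by simp
    qed
  next
    assume "\<forall>k\<in>{1..N-1}. \<forall>v\<in>tangent_space M (g k). B (k - 1) v + A k v = 0"
    then show "\<forall>\<delta>\<in>variations M N g. (\<Sum>k<N. A k (\<delta> k) + B k (\<delta> (Suc k))) = 0"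
      using parts by (auto simp: variations_def intro!: sum.neutral)
  qed
qed

section \<open>Reduction of the Lagrangian\<close>

locale reduced_lagrangian = lie_group G M
  for G :: "('g, 'x) monoid_scheme" (structure)
    and M :: "('g, 'e::real_normed_vector) manifold" +
  fixes L :: "'g \<times> 'g \<Rightarrow> real" and l :: "'g \<Rightarrow> real"
  assumes differentiable: "differentiable_fun (prod_manifold M M) L"
    and restriction: "\<And>g1 g2. g1 \<in> carrier G \<Longrightarrow> g2 \<in> carrier G \<Longrightarrow> l (g1 \<otimes> inv g2) = L (g1, g2)"
begin

lemma lagrangian_diff2_at:
  "p \<in> carrier G \<Longrightarrow> q \<in> carrier G \<Longrightarrow> diff2_at M M real_line L p q"
  by (rule differentiable_fun_diff2_at[OF manifold manifold differentiable]) (simp_all add: in_carrier_iff)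

text \<open>
  On the group \<open>l\<close> is the slice \<open>x \<mapsto> L (x, \<one>)\<close> of \<open>L\<close>, so it inherits differentiability.
\<close>

lemma reduced_lagrangian_diff_at:
  assumes f: "f \<in> carrier G"
  shows "diff_at M real_line l f"
  unfolding diff_at_def topspace_real_line charts_at_real_line
proof (intro conjI allI impI)
  show "f \<in> topspace (topol M)" using f by (simp add: in_carrier_iff)
  fix U \<phi> and W :: "real set" and \<eta> :: "real \<Rightarrow> real"
  assume U: "(U, \<phi>) \<in> charts_at M f" and "(W, \<eta>) \<in> {(UNIV, \<lambda>x. x)}"
  then have W: "W = UNIV" "\<eta> = (\<lambda>x. x)" by simp_all
  then show "\<forall>\<^sub>F x in nhds (\<phi> f). l (inv_into U \<phi> x) \<in> W" by simp
  note U' = chart_in_atlas[OF U]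
  have "(L \<circ> (\<lambda>x. (x, \<one>)) \<circ> inv_into U \<phi>) differentiable (at (\<phi> f))"
    using diff_atD(4)[OF diff2_at_fst[OF manifold manifold lagrangian_diff2_at[OF f one_closed]] U, of UNIV "\<lambda>x. x"]
    by (simp add: charts_at_real_line comp_def)
  moreover have "\<forall>\<^sub>F x in nhds (\<phi> f). (L \<circ> (\<lambda>x. (x, \<one>)) \<circ> inv_into U \<phi>) x = (\<eta> \<circ> l \<circ> inv_into U \<phi>) x"
    unfolding eventually_nhds
  proof (intro exI[of _ "\<phi> ` U"] conjI ballI)
    show "open (\<phi> ` U)" by (rule chart_open_image[OF manifold U'])
    show "\<phi> f \<in> \<phi> ` U" using chart_mem[OF U] by simp
    fix x assume "x \<in> \<phi> ` U"
    then have "inv_into U \<phi> x \<in> carrier G"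
      using inv_into_into[of x \<phi> U] openin_subset[OF chart_openin[OF manifold U']] in_carrier_iff by blast
    from restriction[OF this one_closed] this
    show "(L \<circ> (\<lambda>x. (x, \<one>)) \<circ> inv_into U \<phi>) x = (\<eta> \<circ> l \<circ> inv_into U \<phi>) x"
      by (simp add: W)
  qed
  ultimately show "(\<eta> \<circ> l \<circ> inv_into U \<phi>) differentiable (at (\<phi> f))"
    by (rule differentiable_eventually)
qed simp

text \<open>
  The heart of the reduction. Both sides are the derivative at \<open>0\<close> of the same function
  \<open>t \<mapsto> l (a t \<otimes> inv (b t)) = L (a t, b t)\<close>, for curves with velocities \<open>v\<close> and \<open>w\<close>.
\<close>

lemma reduced_differential:
  assumes p: "p \<in> carrier G" and q: "q \<in> carrier G"
    and v: "v \<in> tangent_space M p" and w: "w \<in> tangent_space M q"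
  shows "differential M l (p \<otimes> inv q)
      (TR G M (p \<otimes> inv q) \<one> (TR G M (inv p) p v - Ad G M (p \<otimes> inv q) (TR G M (inv q) q w))) =
    D1 M L (p, q) v + D2 M L (p, q) w"
proof -
  obtain a where a: "has_velocity M a p v"
    using curve_exists[OF p v] by blast
  obtain b where b: "has_velocity M b q w"
    using curve_exists[OF q w] by blast
  let ?v = "TR G M (p \<otimes> inv q) \<one> (TR G M (inv p) p v - Ad G M (p \<otimes> inv q) (TR G M (inv q) q w))"
  have "((\<lambda>t. l (a t \<otimes> inv (b t))) has_real_derivative differential M l (p \<otimes> inv q) ?v) (at 0)"
    by (rule differential_along_curve[OF manifold reduced_lagrangian_diff_at has_velocity_quotient[OF a b]])
      (simp add: p q)
  then have "((\<lambda>t. L (a t, b t)) has_vector_derivative differential M l (p \<otimes> inv q) ?v) (at 0)"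
    unfolding has_real_derivative_iff_has_vector_derivative
  proof (rule has_vector_derivative_eventually)
    show "\<forall>\<^sub>F t in nhds 0. l (a t \<otimes> inv (b t)) = L (a t, b t)"
      using eventually_in_carrier[OF a] eventually_in_carrier[OF b]
      by eventually_elim (rule restriction)
  qed
  moreover have "((\<lambda>t. L (a t, b t)) has_real_derivative D1 M L (p, q) v + D2 M L (p, q) w) (at 0)"
    by (rule differential_along_curve2[OF manifold lagrangian_diff2_at[OF p q] a b])
  ultimately show ?thesis
    unfolding has_real_derivative_iff_has_vector_derivative by (rule vector_derivative_unique_at)
qed

lemma reduced_differential_diff:
  "f \<in> carrier G \<Longrightarrow> differential M l f (v - w) = differential M l f v - differential M l f w"
  by (simp add: differential_eq_tangent_map tangent_map_diff[OF manifold reduced_lagrangian_diff_at])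

lemma reduced_differential_zero: "f \<in> carrier G \<Longrightarrow> differential M l f zero_tvec = 0"
  using tangent_map_zero[OF manifold reduced_lagrangian_diff_at]
  by (simp add: differential_eq_tangent_map zero_tvec_def)

lemma zero_tangent:
  assumes "p \<in> carrier G"
  shows "zero_tvec \<in> tangent_space M p"
  using has_velocity_tangent[OF manifold has_velocity_const] assms by (simp add: in_carrier_iff)

lemma D1_zero: "p \<in> carrier G \<Longrightarrow> q \<in> carrier G \<Longrightarrow> D1 M L (p, q) zero_tvec = 0"
  using tangent_map_zero[OF manifold diff2_at_fst[OF manifold manifold lagrangian_diff2_at]]
  by (simp add: D1_def differential_eq_tangent_map zero_tvec_def)

lemma D2_zero: "p \<in> carrier G \<Longrightarrow> q \<in> carrier G \<Longrightarrow> D2 M L (p, q) zero_tvec = 0"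
  using tangent_map_zero[OF manifold diff2_at_snd[OF manifold manifold lagrangian_diff2_at]]
  by (simp add: D2_def differential_eq_tangent_map zero_tvec_def)

context
  fixes g :: "nat \<Rightarrow> 'g" and N :: nat
  assumes g: "\<And>k. k \<le> N \<Longrightarrow> g k \<in> carrier G"
begin

abbreviation first_variation :: "(nat \<Rightarrow> ('g, 'e) tvec) \<Rightarrow> real" where
  "first_variation \<delta> \<equiv> \<Sum>k<N. D1 M L (g k, g (Suc k)) (\<delta> k) + D2 M L (g k, g (Suc k)) (\<delta> (Suc k))"

lemma first_variation_vanishes_iff:
  "(\<forall>\<delta>\<in>variations M N g. first_variation \<delta> = 0) \<longleftrightarrow> discrete_euler_lagrange M L N g"
proof -
  have "(\<forall>\<delta>\<in>variations M N g. first_variation \<delta> = 0) \<longleftrightarrow>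
    (\<forall>k\<in>{1..N-1}. \<forall>v\<in>tangent_space M (g k).
      D2 M L (g (k - 1), g (Suc (k - 1))) v + D1 M L (g k, g (Suc k)) v = 0)"
    by (rule sum_vanishes_iff_stationary) (use g in \<open>simp_all add: D1_zero D2_zero zero_tangent\<close>)
  then show ?thesis by (simp add: discrete_euler_lagrange_def)
qed

lemma extremal_iff_euler_lagrange:
  "extremal_for M {..N} (action_sum L N) g (variations M N g) \<longleftrightarrow> discrete_euler_lagrange M L N g"
  unfolding first_variation_vanishes_iff[symmetric]
proof (rule extremal_for_iff_first_variation[OF _ manifold])
  fix \<delta> assume \<delta>: "\<delta> \<in> variations M N g"
  show "\<exists>c. smooth_curve M c \<and> has_velocity M c (g i) (\<delta> i)" if "i \<in> {..N}" for i
    using curve_exists[of "g i" "\<delta> i"] g \<delta> that by (simp add: variations_def)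
  fix \<gamma> assume \<gamma>: "\<And>i. i \<in> {..N} \<Longrightarrow> has_velocity M (\<gamma> i) (g i) (\<delta> i)"
  show "((\<lambda>\<epsilon>. action_sum L N (\<lambda>i. \<gamma> i \<epsilon>)) has_real_derivative first_variation \<delta>) (at 0)"
    unfolding action_sum_def
  proof (rule DERIV_sum)
    fix k assume "k \<in> {..<N}"
    then have k: "k \<le> N" "Suc k \<le> N" by auto
    show "((\<lambda>\<epsilon>. L (\<gamma> k \<epsilon>, \<gamma> (Suc k) \<epsilon>)) has_real_derivative
        D1 M L (g k, g (Suc k)) (\<delta> k) + D2 M L (g k, g (Suc k)) (\<delta> (Suc k))) (at 0)"
      using k by (intro differential_along_curve2[OF manifold lagrangian_diff2_at] g \<gamma>) auto
  qed
qed

lemma reduced_sequence_in_carrier: "k < N \<Longrightarrow> reduced_sequence G g k \<in> carrier G"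
  using g by (simp add: reduced_sequence_def)

lemma reduced_variation_velocity:
  assumes "k < N" and "has_velocity M (\<gamma> k) (g k) (\<delta> k)"
    and "has_velocity M (\<gamma> (Suc k)) (g (Suc k)) (\<delta> (Suc k))"
  shows "has_velocity M (\<lambda>\<epsilon>. reduced_sequence G (\<lambda>i. \<gamma> i \<epsilon>) k) (reduced_sequence G g k)
    (reduced_variation G M g \<delta> k)"
  using has_velocity_quotient[OF assms(2,3)] by (simp add: reduced_sequence_def reduced_variation_def)

lemma reduced_variation_tangent:
  assumes "k < N" and "\<delta> \<in> variations M N g"
  shows "reduced_variation G M g \<delta> k \<in> tangent_space M (reduced_sequence G g k)"
proof -
  have "\<exists>c. has_velocity M c (g i) (\<delta> i)" if "i \<le> N" for i
    using curve_exists[of "g i" "\<delta> i"] g assms that by (auto simp: variations_def)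
  from this[of k] this[of "Suc k"] assms(1)
  obtain a b where "has_velocity M a (g k) (\<delta> k)" "has_velocity M b (g (Suc k)) (\<delta> (Suc k))" by auto
  from has_velocity_tangent[OF manifold has_velocity_quotient[OF this]]
  show ?thesis by (simp add: reduced_sequence_def reduced_variation_def)
qed

lemma differential_reduced_variation:
  assumes "k < N" and "\<delta> \<in> variations M N g"
  shows "differential M l (reduced_sequence G g k) (reduced_variation G M g \<delta> k) =
    D1 M L (g k, g (Suc k)) (\<delta> k) + D2 M L (g k, g (Suc k)) (\<delta> (Suc k))"
  using reduced_differential[of "g k" "g (Suc k)" "\<delta> k" "\<delta> (Suc k)"] g assms
  by (simp add: reduced_sequence_def reduced_variation_def variations_def)

lemma reduced_extremal_iff_euler_lagrange:
  "extremal_for M {..<N} (reduced_action_sum l N) (reduced_sequence G g)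
      (reduced_variation G M g ` variations M N g) \<longleftrightarrow> discrete_euler_lagrange M L N g"
proof -
  let ?f = "reduced_sequence G g"
  have "extremal_for M {..<N} (reduced_action_sum l N) ?f (reduced_variation G M g ` variations M N g)
    \<longleftrightarrow> (\<forall>\<delta>\<in>reduced_variation G M g ` variations M N g. (\<Sum>k<N. differential M l (?f k) (\<delta> k)) = 0)"
  proof (rule extremal_for_iff_first_variation[OF _ manifold])
    fix \<delta> assume \<delta>: "\<delta> \<in> reduced_variation G M g ` variations M N g"
    show "\<exists>c. smooth_curve M c \<and> has_velocity M c (?f i) (\<delta> i)" if "i \<in> {..<N}" for i
      using that \<delta> by (auto intro!: curve_exists reduced_variation_tangent reduced_sequence_in_carrier)
    fix \<gamma> assume \<gamma>: "\<And>i. i \<in> {..<N} \<Longrightarrow> has_velocity M (\<gamma> i) (?f i) (\<delta> i)"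
    show "((\<lambda>\<epsilon>. reduced_action_sum l N (\<lambda>i. \<gamma> i \<epsilon>)) has_real_derivative
        (\<Sum>k<N. differential M l (?f k) (\<delta> k))) (at 0)"
      unfolding reduced_action_sum_def
      by (intro DERIV_sum differential_along_curve[OF manifold reduced_lagrangian_diff_at]
          reduced_sequence_in_carrier \<gamma>) simp_all
  qed
  also have "\<dots> \<longleftrightarrow> (\<forall>\<delta>\<in>variations M N g. first_variation \<delta> = 0)"
    by (simp add: differential_reduced_variation)
  finally show ?thesis by (simp only: first_variation_vanishes_iff)
qed

text \<open>
  Split \<open>reduced_differential\<close> into its two summands by setting one of the variations to \<open>0\<close>.
\<close>

lemma euler_poincare_iff_euler_lagrange:
  "discrete_euler_poincare G M l N (reduced_sequence G g) \<longleftrightarrow> discrete_euler_lagrange M L N g"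
proof -
  let ?f = "reduced_sequence G g"
  \<comment> \<open>Here \<open>\<theta>\<close> is the right translate of \<open>v\<close> to the identity.\<close>
  have eq: "- differential M l (?f (k - 1)) (TR G M (?f (k - 1)) \<one> (Ad G M (?f (k - 1)) (TR G M (inv (g k)) (g k) v)))
      + differential M l (?f k) (TR G M (?f k) \<one> (TR G M (inv (g k)) (g k) v))
      = D2 M L (g (k - 1), g k) v + D1 M L (g k, g (k + 1)) v"
    if k: "k \<in> {1..N-1}" and v: "v \<in> tangent_space M (g k)" for k v
  proof -
    have c: "g (k - 1) \<in> carrier G" "g k \<in> carrier G" "g (k + 1) \<in> carrier G"
      using g k by auto
    have f: "?f (k - 1) = g (k - 1) \<otimes> inv (g k)" "?f k = g k \<otimes> inv (g (k + 1))"
      using k by (simp_all add: reduced_sequence_def)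
    have "differential M l (?f k) (TR G M (?f k) \<one> (TR G M (inv (g k)) (g k) v)) = D1 M L (g k, g (k + 1)) v"
      using reduced_differential[OF c(2,3) v zero_tangent[OF c(3)]] c
      by (simp add: f TR_zero Ad_zero D2_zero) (simp add: zero_tvec_def fun_diff_def)
    moreover have "- differential M l (?f (k - 1)) (TR G M (?f (k - 1)) \<one> (Ad G M (?f (k - 1)) (TR G M (inv (g k)) (g k) v)))
        = D2 M L (g (k - 1), g k) v"
      using reduced_differential[OF c(1,2) zero_tangent[OF c(1)] v]
      by (simp del: One_nat_def
          add: f TR_zero TR_diff D1_zero c reduced_differential_diff reduced_differential_zero)
    ultimately show ?thesis by simp
  qed
  \<comment> \<open>Translating back by \<open>g k\<close> shows that every \<open>\<theta>\<close> arises in this way.\<close>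
  have "TR G M (inv (g k)) (g k) ` tangent_space M (g k) = lie_algebra G M" if "k \<le> N" for k
  proof (intro equalityI subsetI)
    fix \<theta> assume \<theta>: "\<theta> \<in> lie_algebra G M"
    have "TR G M (g k) \<one> \<theta> \<in> tangent_space M (g k)"
      using TR_tangent[OF one_closed g[OF that] \<theta>] g[OF that] by simp
    moreover have "TR G M (inv (g k)) (g k) (TR G M (g k) \<one> \<theta>) = \<theta>"
      using TR_TR[OF one_closed g[OF that] inv_closed[OF g[OF that]] \<theta>] g[OF that] TR_one[OF one_closed \<theta>]
      by simp
    ultimately show "\<theta> \<in> TR G M (inv (g k)) (g k) ` tangent_space M (g k)" by (metis imageI)
  next
    fix \<theta> assume "\<theta> \<in> TR G M (inv (g k)) (g k) ` tangent_space M (g k)"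
    then show "\<theta> \<in> lie_algebra G M"
      using TR_tangent[OF g[OF that] inv_closed[OF g[OF that]]] g[OF that] by auto
  qed
  then have surj: "lie_algebra G M = TR G M (inv (g k)) (g k) ` tangent_space M (g k)"
    if "k \<in> {1..N-1}" for k
    using that by (metis atLeastAtMost_iff diff_le_self le_trans)
  show ?thesis
    unfolding discrete_euler_poincare_def discrete_euler_lagrange_def
  proof (rule ball_cong[OF refl])
    fix k assume k: "k \<in> {1..N-1}"
    show "(\<forall>\<theta>\<in>lie_algebra G M.
        - differential M l (?f (k - 1)) (TR G M (?f (k - 1)) \<one> (Ad G M (?f (k - 1)) \<theta>))
        + differential M l (?f k) (TR G M (?f k) \<one> \<theta>) = 0) \<longleftrightarrow>
      (\<forall>v\<in>tangent_space M (g k). D2 M L (g (k - 1), g k) v + D1 M L (g k, g (k + 1)) v = 0)"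
      unfolding surj[OF k] ball_simps using eq[OF k] by (metis (no_types, lifting))
  qed
qed

end

end

theorem theorem2p1:
  fixes G :: "('g, 'x) monoid_scheme"
    and M :: "('g, 'e::real_normed_vector) manifold"
    and L :: "'g \<times> 'g \<Rightarrow> real"
    and l :: "'g \<Rightarrow> real"
    and N :: nat
    and g f :: "nat \<Rightarrow> 'g"
  assumes "lie_group G M"
    and "differentiable_fun (prod_manifold M M) L"
    and "right_invariant G L"
    and "\<And>g1 g2. g1 \<in> carrier G \<Longrightarrow> g2 \<in> carrier G \<Longrightarrow> l (g1 \<otimes>\<^bsub>G\<^esub> inv\<^bsub>G\<^esub> g2) = L (g1, g2)"
    and "N \<ge> 3"
    and "\<And>k. k \<le> N \<Longrightarrow> g k \<in> carrier G"
    and "f = reduced_sequence G g"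
  shows
    "(extremal_for M {..N} (action_sum L N) g (variations M N g) \<longleftrightarrow>
        discrete_euler_lagrange M L N g) \<and>
     (discrete_euler_lagrange M L N g \<longleftrightarrow>
        extremal_for M {..<N} (reduced_action_sum l N) f
          (reduced_variation G M g ` variations M N g)) \<and>
     (extremal_for M {..<N} (reduced_action_sum l N) f
          (reduced_variation G M g ` variations M N g) \<longleftrightarrow>
        discrete_euler_poincare G M l N f) \<and>
     (\<forall>\<gamma>. (\<forall>k\<le>N. smooth_curve M (\<gamma> k) \<and> \<gamma> k 0 = g k) \<longrightarrow>
        (\<forall>k<N. velocity M (\<lambda>\<epsilon>. reduced_sequence G (\<lambda>i. \<gamma> i \<epsilon>) k) =
               reduced_variation G M g (\<lambda>i. velocity M (\<gamma> i)) k))"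
proof -
  interpret lie_group G M by fact
  interpret reduced_lagrangian G M L l
    by unfold_locales (fact assms(2), fact assms(4))
  have "velocity M (\<lambda>\<epsilon>. reduced_sequence G (\<lambda>i. \<gamma> i \<epsilon>) k) =
      reduced_variation G M g (\<lambda>i. velocity M (\<gamma> i)) k"
    if \<gamma>: "\<forall>k\<le>N. smooth_curve M (\<gamma> k) \<and> \<gamma> k 0 = g k" and k: "k < N" for \<gamma> k
  proof (rule has_velocity_imp_velocity, rule reduced_variation_velocity)
    have "has_velocity M (\<gamma> i) (g i) (velocity M (\<gamma> i))" if "i \<le> N" for i
      using smooth_curve_has_velocity[OF manifold, of "\<gamma> i"] \<gamma> that by simp
    then show "has_velocity M (\<gamma> k) (g k) (velocity M (\<gamma> k))"
      and "has_velocity M (\<gamma> (Suc k)) (g (Suc k)) (velocity M (\<gamma> (Suc k)))"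
      using k by simp_all
  qed (fact assms(6), fact k)
  then show ?thesis
    unfolding assms(7)
    using extremal_iff_euler_lagrange[where g = g and N = N, OF assms(6)]
      reduced_extremal_iff_euler_lagrange[where g = g and N = N, OF assms(6)]
      euler_poincare_iff_euler_lagrange[where g = g and N = N, OF assms(6)] by blast
qed

end
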